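(* Let $\mathcal{C}$ be a crystal framework in $\mathbb{R}^d$ with a given periodic structure and associated geometric flex spectrum $\Gamma(\mathcal{C})$. Then $\mathcal{F}(\mathcal{C};\mathbb{C})$ is finite-dimensional if and only if $\Gamma(\mathcal{C})$ is a finite set.
   Context: A crystal framework $\mathcal{C}=(G,p)$ in $\mathbb{R}^d$ ($d\ge2$): $G=(V,E)$ a countable simple graph, $p:V\to\mathbb{R}^d$ injective, with a periodic structure $a_1,\dots,a_d$ (linearly independent) such that $\mathbb{Z}^d$ acts on $G$ by automorphisms $v\mapsto k\cdot v$ with $p(k\cdot v)=p(v)+\sum_ik_ia_i$, having finitely many vertex and edge orbits. Choose a motif: vertex orbit representatives $F_v=\{v_1,\dots,v_n\}$ and $m$ edge orbit representatives $F_e$; write $(v,k)=k\cdot v$, each motif edge as $e=(v,k)(w,l)$, $v,w\in F_v$, and $p(e)=p(v,k)-p(w,l)$. $\mathcal{F}(\mathcal{C};\mathbb{C})$ is the complex vector space of maps $u:V\to\mathbb{C}^d$ with $(u(x)-u(y))\cdot(p(x)-p(y))=0$ for all edges $xy\in E$. The transfer function $\Psi_{\mathcal{C}}(z)$, $z\in\mathbb{C}_*^d=(\mathbb{C}\setminus\{0\})^d$, is the $m\times dn$ matrix whose row for $e=(v,k)(w,l)$, $v\neq w$, has $p(e)z^{-k}$ in the $d$ columns of $v$, $-p(e)z^{-l}$ in those of $w$, zeros elsewhere, and for $v=w$ has $p(e)(z^{-k}-z^{-l})$ in the columns of $v$ ($z^k=z_1^{k_1}\cdots z_d^{k_d}$).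 The geometric flex spectrum is $\Gamma(\mathcal{C})=\{\omega\in\mathbb{C}_*^d:\ker\Psi_{\mathcal{C}}(\omega^{-1})\ne\{0\}\}$, where $\omega^{-1}=(\omega_1^{-1},\dots,\omega_d^{-1})$. *)

theory Defs
  imports "HOL-Analysis.Analysis" "HOL-Library.Function_Algebras"
begin

text \<open>Dimension d is the cardinality of the finite index type 'd; R^d = real^'d, Z^d = int^'d.
  Vertices have type 'v; V is the vertex set, E the set of (undirected) edges, each a
  two-element subset of V; p is the placement; act k x is the action k.x of k in Z^d;
  a i (i :: 'd) are the period vectors a_1,...,a_d.\<close>

definition crystal_framework ::
  "'v set \<Rightarrow> 'v set set \<Rightarrow> ('v \<Rightarrow> real^'d) \<Rightarrow> (int^'d \<Rightarrow> 'v \<Rightarrow> 'v) \<Rightarrow> ('d \<Rightarrow> real^'d) \<Rightarrow> bool"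
  where
  "crystal_framework V E p act a \<longleftrightarrow>
     countable V \<and>
     E \<subseteq> {{x, y} | x y. x \<in> V \<and> y \<in> V \<and> x \<noteq> y} \<and>
     inj_on p V \<and>
     inj a \<and> independent (range a) \<and>
     (\<forall>x\<in>V. act 0 x = x) \<and>
     (\<forall>k l. \<forall>x\<in>V. act (k + l) x = act k (act l x)) \<and>
     (\<forall>k. bij_betw (act k) V V) \<and>
     (\<forall>k. \<forall>x\<in>V. \<forall>y\<in>V. {x, y} \<in> E \<longleftrightarrow> {act k x, act k y} \<in> E) \<and>
     (\<forall>k. \<forall>x\<in>V. p (act k x) = p x + (\<Sum>i\<in>UNIV. real_of_int (k $ i) *\<^sub>R a i)) \<and>
     finite {{act k x | k. True} | x. x \<in> V} \<and>
     finite {{act k ` e | k. True} | e. e \<in> E}"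

text \<open>A motif: Fv contains exactly one vertex of each vertex orbit; Fe is a set of ordered pairs
  (x,y) whose underlying edges {x,y} form a set of representatives of the edge orbits, exactly
  one per orbit (the ordering of the endpoints only changes the sign of a row of the transfer
  function).\<close>

definition motif ::
  "'v set \<Rightarrow> 'v set set \<Rightarrow> (int^'d \<Rightarrow> 'v \<Rightarrow> 'v) \<Rightarrow> 'v set \<Rightarrow> ('v \<times> 'v) set \<Rightarrow> bool"
  where
  "motif V E act Fv Fe \<longleftrightarrow>
     Fv \<subseteq> V \<and> (\<forall>x\<in>V. \<exists>!v. v \<in> Fv \<and> (\<exists>k. act k v = x)) \<and>
     (\<forall>(x, y)\<in>Fe. {x, y} \<in> E) \<and>
     inj_on (\<lambda>(x, y). {x, y}) Fe \<and>
     (\<forall>e\<in>E. \<exists>!f. f \<in> (\<lambda>(x, y). {x, y}) ` Fe \<and> (\<exists>k. e = act k ` f))"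

definition motif_vertex :: "(int^'d \<Rightarrow> 'v \<Rightarrow> 'v) \<Rightarrow> 'v set \<Rightarrow> 'v \<Rightarrow> 'v" where
  "motif_vertex act Fv x = (THE v. v \<in> Fv \<and> (\<exists>k. act k v = x))"

definition motif_shift :: "(int^'d \<Rightarrow> 'v \<Rightarrow> 'v) \<Rightarrow> 'v set \<Rightarrow> 'v \<Rightarrow> int^'d" where
  "motif_shift act Fv x = (THE k. act k (motif_vertex act Fv x) = x)"

definition zmono :: "complex^'d \<Rightarrow> int^'d \<Rightarrow> complex" where
  "zmono z k = (\<Prod>i\<in>UNIV. (z $ i) powi (k $ i))"

text \<open>Transfer function: the entry of Psi(z) in the row of the motif edge e = (x,y) and in the
  column (v,i) (v in Fv, i-th coordinate).  With x = (v',k), y = (w',l), p(e) = p x - p y, this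
  is p(e)_i z^-k [v = v'] - p(e)_i z^-l [v = w'], which gives both cases v' \<noteq> w' and v' = w'.\<close>

definition transfer_fn ::
  "('v \<Rightarrow> real^'d) \<Rightarrow> (int^'d \<Rightarrow> 'v \<Rightarrow> 'v) \<Rightarrow> 'v set \<Rightarrow> complex^'d \<Rightarrow> ('v \<times> 'v) \<Rightarrow> ('v \<times> 'd) \<Rightarrow> complex"
  where
  "transfer_fn p act Fv z e c =
     (let x = fst e; y = snd e; pe = p x - p y; v = fst c; i = snd c in
       (if v = motif_vertex act Fv x then complex_of_real (pe $ i) * zmono z (- motif_shift act Fv x) else 0)
     - (if v = motif_vertex act Fv y then complex_of_real (pe $ i) * zmono z (- motif_shift act Fv y) else 0))"

definition flex_spectrum ::
  "('v \<Rightarrow> real^'d) \<Rightarrow> (int^'d \<Rightarrow> 'v \<Rightarrow> 'v) \<Rightarrow> 'v set \<Rightarrow> ('v \<times> 'v) set \<Rightarrow> (complex^'d) set"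
  where
  "flex_spectrum p act Fv Fe =
     {\<omega>. (\<forall>i. \<omega> $ i \<noteq> 0) \<and>
          (\<exists>u :: 'v \<times> 'd \<Rightarrow> complex. (\<exists>c\<in>Fv \<times> UNIV. u c \<noteq> 0) \<and>
             (\<forall>e\<in>Fe. (\<Sum>c\<in>Fv \<times> UNIV.
                 transfer_fn p act Fv (\<chi> i. inverse (\<omega> $ i)) e c * u c) = 0))}"

definition flex_space ::
  "'v set \<Rightarrow> 'v set set \<Rightarrow> ('v \<Rightarrow> real^'d) \<Rightarrow> ('v \<Rightarrow> complex^'d) set" where
  "flex_space V E p =
     {u. (\<forall>x. x \<notin> V \<longrightarrow> u x = 0) \<and>
         (\<forall>x y. {x, y} \<in> E \<longrightarrow>
            (\<Sum>i\<in>UNIV. (u x $ i - u y $ i) * complex_of_real (p x $ i - p y $ i)) = 0)}"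

definition flex_scale :: "complex \<Rightarrow> ('v \<Rightarrow> complex^'d) \<Rightarrow> ('v \<Rightarrow> complex^'d)" where
  "flex_scale c u = (\<lambda>x. c *s u x)"

definition fin_dim_flex :: "('v \<Rightarrow> complex^'d) set \<Rightarrow> bool" where
  "fin_dim_flex S \<longleftrightarrow> (\<exists>B. finite B \<and> B \<subseteq> S \<and> S \<subseteq> module.span flex_scale B)"

end

theory Submission
  imports Defs "HOL-Computational_Algebra.Fundamental_Theorem_Algebra"
begin

text \<open>
  A point \<open>\<omega>\<close> of the spectrum carries a nonzero flex that is multiplied by \<open>\<omega>\<^sup>k\<close> under
  translation by k, and such flexes are linearly independent for distinct \<open>\<omega>\<close>. Hence an infinite
  spectrum forces infinite dimension.

  For the converse, let M be the span of the coordinate evaluations on the flex space: a module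
  over the group ring of \<open>\<int>\<^sup>d\<close>, generated by the finitely many evaluations at motif vertices. Fix a
  coordinate i, let e be the i-th unit vector and q the polynomial whose roots are the i-th
  coordinates of the spectrum. If q(e) did not act nilpotently on M, choose a submodule N maximal
  among those for which q(e) is not nilpotent on M/N. Every nonzero submodule of M/N contains the
  image of a power of q(e), and as M has countable dimension over the uncountable field of complex
  numbers, every translation acts on M/N as a scalar. A linear functional on M/N is then a flex with
  multiplier \<open>\<omega>\<close> in the spectrum but \<open>q(\<omega>\<^sub>i) \<noteq> 0\<close>, a contradiction. So every flex satisfies, in each
  coordinate direction, a linear recurrence with nonzero extreme coefficients, and is determined by
  its values on a finite box.
\<close>

section \<open>Linear algebra: dependent families, separating functionals, common zeros\<close>

locale complex_space = vector_space scale for scale :: "complex \<Rightarrow> 'b::ab_group_add \<Rightarrow> 'b"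
begin

text \<open>An infinite set in the span of a finite set is dependent; if \<open>w\<close> repeats a
  value, the coefficients 1 and -1 already give a relation. Indexing the relation by
  \<open>L\<close> keeps the labels, which later are resolvent parameters or spectral
  points.\<close>

lemma infinite_family_dependent:
  assumes "infinite L" "finite F" "\<And>l. l \<in> L \<Longrightarrow> w l \<in> span F"
  obtains A c where "finite A" "A \<subseteq> L" "\<exists>l\<in>A. c l \<noteq> 0" "(\<Sum>l\<in>A. scale (c l) (w l)) = 0"
proof (cases "inj_on w L")
  case True
  have "infinite (w ` L)"
    using True assms(1) finite_imageD by blast
  then have "dependent (w ` L)"
    using independent_span_bound[OF assms(2), of "w ` L"] assms(3) by blast
  then obtain B u where B: "finite B" "B \<subseteq> w ` L" "(\<Sum>v\<in>B. scale (u v) v) = 0" "\<exists>v\<in>B. u v \<noteq> 0"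
    unfolding dependent_explicit by blast
  obtain A where A: "A \<subseteq> L" "B = w ` A"
    using B(2) by (auto simp: subset_image_iff)
  have inj: "inj_on w A"
    using True A(1) inj_on_subset by blast
  show thesis
  proof (rule that[of A "u \<circ> w"])
    show "finite A" using B(1) A(2) inj finite_imageD by blast
    show "A \<subseteq> L" by fact
    show "\<exists>l\<in>A. (u \<circ> w) l \<noteq> 0" using B(4) A(2) by auto
    show "(\<Sum>l\<in>A. scale ((u \<circ> w) l) (w l)) = 0"
      using B(3) unfolding A(2) by (subst (asm) sum.reindex[OF inj]) simp
  qed
next
  case False
  then obtain l m where lm: "l \<in> L" "m \<in> L" "l \<noteq> m" "w l = w m"
    unfolding inj_on_def by blast
  show thesis
    by (rule that[of "{l, m}" "\<lambda>j. if j = l then 1 else - 1"]) (use lm in auto)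
qed

text \<open>A basis of \<open>N\<close> stays independent when \<open>w\<close> is added, so the
  values 0 on the basis and 1 at \<open>w\<close> extend linearly. Such an \<open>f\<close> acts as
  a functional on the quotient by \<open>N\<close>, without a quotient type being formed.\<close>

lemma exists_functional_vanishing_on:
  assumes "subspace N" "w \<notin> N"
  obtains f :: "'b \<Rightarrow> complex" where "\<And>x y. f (x + y) = f x + f y" "\<And>c x. f (scale c x) = c * f x"
    "\<And>x. x \<in> N \<Longrightarrow> f x = 0" "f w = 1"
proof -
  interpret P: vector_space_pair scale "(*) :: complex \<Rightarrow> complex \<Rightarrow> complex"
    by unfold_locales (auto simp: algebra_simps)
  obtain B where B: "B \<subseteq> N" "independent B" "N \<subseteq> span B"
    by (rule maximal_independent_subset)
  have "w \<notin> span B"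
    using assms B(1) span_minimal by blast
  then have "independent (insert w B)"
    using B(2) independent_insertI by blast
  then obtain f where f: "Vector_Spaces.linear scale (*) f" "\<forall>x\<in>insert w B. f x = (if x = w then 1 else 0)"
    using P.linear_independent_extend[of "insert w B" "\<lambda>x. if x = w then 1 else 0"] by blast
  interpret f: Vector_Spaces.linear scale "(*)" f
    by (rule f(1))
  have "f x = 0" if "x \<in> N" for x
  proof (rule P.linear_eq_0_on_span[OF f(1)])
    show "x \<in> span B" using that B(3) by blast
    show "f b = 0" if "b \<in> B" for b
      using f(2) that \<open>w \<notin> span B\<close> span_base[of b B] by auto
  qed
  then show thesis
    using f(2) by (intro that[of f]) (auto simp: f.add f.scale)
qed

text \<open>Each functional lowers the dimension of the common zero space by at most one, so one
  vector per functional makes up the loss. The vectors come from \<open>F\<close> itself because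
  \<open>fin_dim_flex\<close> asks for a spanning set inside the space.\<close>

lemma finite_span_modulo_functionals:
  fixes C :: "('b \<Rightarrow> complex) set"
  assumes "finite C" "subspace F"
    and "\<And>f x y. f \<in> C \<Longrightarrow> f (x + y) = f x + f y" "\<And>f c x. f \<in> C \<Longrightarrow> f (scale c x) = c * f x"
  shows "\<exists>B. finite B \<and> B \<subseteq> F \<and> F \<subseteq> span (B \<union> {x\<in>F. \<forall>f\<in>C. f x = 0})"
  using assms(1,3,4)
proof (induction C rule: finite_induct)
  case empty
  show ?case by (rule exI[of _ "{}"]) (auto intro: span_base)
next
  case (insert h C)
  let ?Z = "\<lambda>C. {x\<in>F. \<forall>f\<in>C. f x = 0}"
  have add: "f (x + y) = f x + f y" and scl: "f (scale c x) = c * f x" if "f \<in> insert h C" for f x y c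
    using insert.prems that by auto
  have "\<exists>B. finite B \<and> B \<subseteq> F \<and> F \<subseteq> span (B \<union> ?Z C)"
    by (rule insert.IH) (use add scl in auto)
  then obtain B where B: "finite B" "B \<subseteq> F" "F \<subseteq> span (B \<union> ?Z C)"
    by blast
  show ?case
  proof (cases "\<forall>x\<in>?Z C. h x = 0")
    case True
    then have eq: "?Z (insert h C) = ?Z C" by auto
    show ?thesis unfolding eq using B by blast
  next
    case False
    then obtain b where b: "b \<in> ?Z C" "h b \<noteq> 0" by blast
    have "?Z C \<subseteq> span (insert b B \<union> ?Z (insert h C))" (is "_ \<subseteq> span ?S")
    proof
      fix x assume x: "x \<in> ?Z C"
      \<comment> \<open>The multiple of \<open>b\<close> cancels the value of \<open>h\<close>; the
        functionals in \<open>C\<close> vanish at both \<open>x\<close> and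
        \<open>b\<close>.\<close>
      define y where "y = x + scale (- (h x / h b)) b"
      have "y \<in> F"
        unfolding y_def using x b assms(2) by (intro subspace_add subspace_scale) auto
      moreover have "f y = 0" if "f \<in> insert h C" for f
        using that x b unfolding y_def add[OF that] scl[OF that] by auto
      ultimately have "y \<in> ?S" by auto
      then have "y + scale (h x / h b) b \<in> span ?S"
        by (intro span_add span_scale span_base) auto
      then show "x \<in> span ?S" by (simp add: y_def)
    qed
    moreover have "B \<subseteq> span ?S" by (auto intro: span_base)
    ultimately have "span (B \<union> ?Z C) \<subseteq> span ?S"
      by (intro span_minimal subspace_span) simp
    with B(3) have "F \<subseteq> span ?S" by (rule subset_trans)
    then show ?thesis
      using B b(1) by (intro exI[of _ "insert b B"]) auto
  qed
qed

section \<open>Polynomials in a linear operator\<close>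

definition poly_act :: "('b \<Rightarrow> 'b) \<Rightarrow> complex poly \<Rightarrow> 'b \<Rightarrow> 'b" where
  "poly_act T q w = (\<Sum>i\<le>degree q. scale (poly.coeff q i) ((T ^^ i) w))"

lemma poly_act_0 [simp]: "poly_act T 0 w = 0"
  by (simp add: poly_act_def)

context
  fixes T :: "'b \<Rightarrow> 'b"
  assumes T_add: "\<And>x y. T (x + y) = T x + T y"
    and T_scale: "\<And>c x. T (scale c x) = scale c (T x)"
begin

lemma op_zero: "T 0 = 0"
  using T_scale[of 0 0] by simp

lemma op_sum: "T (sum f A) = (\<Sum>a\<in>A. T (f a))"
  by (induction A rule: infinite_finite_induct) (auto simp: op_zero T_add)

lemma poly_act_pCons [simp]: "poly_act T (pCons a q) w = scale a w + T (poly_act T q w)"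
proof (cases "q = 0")
  case True
  then show ?thesis by (auto simp: poly_act_def op_zero)
next
  case False
  then show ?thesis
    by (simp add: poly_act_def sum.atMost_Suc_shift op_sum T_scale del: sum.atMost_Suc)
qed

lemma poly_act_add_left: "poly_act T (q + r) w = poly_act T q w + poly_act T r w"
  by (induction q r rule: poly_induct2) (simp_all add: T_add scale_left_distrib algebra_simps)

lemma poly_act_smult: "poly_act T (smult c q) w = scale c (poly_act T q w)"
  by (induction q) (simp_all add: T_scale scale_right_distrib)

lemma poly_act_sum_left: "poly_act T (sum f A) w = (\<Sum>a\<in>A. poly_act T (f a) w)"
  by (induction A rule: infinite_finite_induct) (auto simp: poly_act_add_left)

lemma poly_act_add: "poly_act T q (v + w) = poly_act T q v + poly_act T q w"
  by (induction q) (simp_all add: T_add scale_right_distrib algebra_simps)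

lemma poly_act_scale: "poly_act T q (scale c w) = scale c (poly_act T q w)"
  by (induction q) (simp_all add: T_scale scale_right_distrib mult.commute)

lemma poly_act_zero: "poly_act T q 0 = 0"
  using poly_act_scale[of q 0 0] by simp

lemma poly_act_diff: "poly_act T q (v - w) = poly_act T q v - poly_act T q w"
  using poly_act_add[of q v "- w"] poly_act_scale[of q "- 1" w] by simp

lemma poly_act_sum: "poly_act T q (sum f A) = (\<Sum>a\<in>A. poly_act T q (f a))"
  by (induction A rule: infinite_finite_induct) (auto simp: poly_act_zero poly_act_add)

lemma poly_act_mult: "poly_act T (q * r) w = poly_act T q (poly_act T r w)"
  by (induction q) (simp_all add: poly_act_add_left poly_act_smult)

lemma poly_act_commute:
  assumes "\<And>x y. U (x + y) = U x + U y" "\<And>c x. U (scale c x) = scale c (U x)"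
    and "\<And>x. U (T x) = T (U x)"
  shows "U (poly_act T q w) = poly_act T q (U w)"
proof (induction q)
  case 0
  show ?case using assms(2)[of 0 0] by simp
qed (simp_all add: assms)

lemma poly_act_in_subspace:
  assumes "subspace N" "\<And>x. x \<in> N \<Longrightarrow> T x \<in> N" "w \<in> N"
  shows "poly_act T q w \<in> N"
  by (induction q) (use assms in \<open>auto intro: subspace_add subspace_scale subspace_0\<close>)

text \<open>Horner's scheme: the new error is \<open>T\<close> applied to the previous error plus a
  multiple of the defect \<open>T w - scale l w\<close>, and both lie in the \<open>T\<close>-stable
  subspace \<open>N\<close>.\<close>

lemma poly_act_eigenvector_modulo:
  assumes "subspace N" "\<And>x. x \<in> N \<Longrightarrow> T x \<in> N" "T w - scale l w \<in> N"
  shows "poly_act T q w - scale (poly q l) w \<in> N"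
proof (induction q)
  case 0
  show ?case using assms(1) by (simp add: subspace_0)
next
  case (pCons a q)
  have T_diff: "T (x - y) = T x - T y" for x y
    using T_add[of x "scale (- 1) y"] T_scale[of "- 1" y] by simp
  have "poly_act T (pCons a q) w - scale (poly (pCons a q) l) w
      = T (poly_act T q w - scale (poly q l) w) + scale (poly q l) (T w - scale l w)"
    by (simp add: T_diff T_scale algebra_simps scale_right_diff_distrib)
  also have "\<dots> \<in> N"
    using pCons.IH assms by (intro subspace_add subspace_scale) auto
  finally show ?case .
qed

end


text \<open>Complex polynomials split into linear factors, and each factor is injective modulo
  \<open>N\<close>, so roots are removed one at a time. Stability of \<open>M\<close> keeps the
  intermediate vectors where the injectivity hypothesis applies.\<close>

lemma poly_act_injective_modulo:
  assumes T: "\<And>x y. T (x + y) = T x + T y" "\<And>c x. T (scale c x) = scale c (T x)"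
    and M: "subspace M" "\<And>x. x \<in> M \<Longrightarrow> T x \<in> M"
    and N: "subspace N" "\<And>l x. x \<in> M \<Longrightarrow> T x - scale l x \<in> N \<Longrightarrow> x \<in> N"
    and "q \<noteq> 0" "w \<in> M" "poly_act T q w \<in> N"
  shows "w \<in> N"
  using assms(7-)
proof (induction "degree q" arbitrary: q w)
  case 0
  then obtain a where "q = [:a:]" "a \<noteq> 0"
    by (metis degree_eq_zeroE pCons_0_0)
  then have "w = scale (inverse a) (poly_act T q w)"
    by (simp add: poly_act_def)
  then show ?case
    using \<open>poly_act T q w \<in> N\<close> N(1) subspace_scale by metis
next
  case (Suc n)
  then obtain z where "poly q z = 0"
    using fundamental_theorem_of_algebra[of q] constant_degree[of q] by auto
  then obtain r where r: "q = [:- z, 1:] * r"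
    by (auto simp: poly_eq_0_iff_dvd)
  have "r \<noteq> 0" using r Suc.prems by auto
  moreover have "degree r = n"
    using Suc.hyps(2) r \<open>r \<noteq> 0\<close> by (simp add: degree_mult_eq del: mult_pCons_left)
  moreover have "poly_act T r w \<in> N"
  proof (rule N(2))
    show "poly_act T r w \<in> M"
      by (rule poly_act_in_subspace[OF T M]) (use Suc.prems in auto)
    have "poly_act T q w = T (poly_act T r w) - scale z (poly_act T r w)"
      unfolding r by (simp add: poly_act_mult[OF T] poly_act_pCons[OF T] T(1) op_zero[OF T] del: mult_pCons_left)
    then show "T (poly_act T r w) - scale z (poly_act T r w) \<in> N"
      using Suc.prems by simp
  qed
  ultimately show ?case
    using Suc.hyps(1) Suc.prems by blast
qed

end

section \<open>Finitely generated modules over a group ring and their submodules\<close>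

locale group_rep = complex_space scale
  for scale :: "complex \<Rightarrow> 'b::ab_group_add \<Rightarrow> 'b" +
  fixes S :: "'k::{ab_group_add, countable} \<Rightarrow> 'b \<Rightarrow> 'b" and G :: "'b set"
  assumes S_add: "S k (x + y) = S k x + S k y"
    and S_scale: "S k (scale c x) = scale c (S k x)"
    and S_S: "S k (S l x) = S (k + l) x"
    and S_0: "g \<in> G \<Longrightarrow> S 0 g = g"
    and finite_G: "finite G"
begin

definition gens :: "'b set" where "gens = (\<Union>k. S k ` G)"

definition M :: "'b set" where "M = span gens"

definition invariant :: "'b set \<Rightarrow> bool" where
  "invariant N \<longleftrightarrow> subspace N \<and> N \<subseteq> M \<and> (\<forall>k. \<forall>x\<in>N. S k x \<in> N)"

lemma S_diff: "S k (x - y) = S k x - S k y"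
  using S_add[of k x "- y"] S_scale[of k "- 1" y] by simp

lemma S_commute: "S k (S l x) = S l (S k x)"
  by (simp add: S_S add.commute)

lemma countable_gens: "countable gens"
  unfolding gens_def using finite_G by (auto intro: countable_finite)

lemma subspace_M: "subspace M"
  by (simp add: M_def subspace_span)

lemma G_subset_M: "G \<subseteq> M"
proof
  fix g assume "g \<in> G"
  then have "g \<in> gens"
    using S_0[of g] unfolding gens_def by (metis UNIV_I UN_I image_eqI)
  then show "g \<in> M" by (simp add: M_def span_base)
qed

lemma M_induct [consumes 1, case_names gen add scale zero]:
  assumes "w \<in> M" and "\<And>k g. g \<in> G \<Longrightarrow> P (S k g)"
    and "\<And>x y. x \<in> M \<Longrightarrow> y \<in> M \<Longrightarrow> P x \<Longrightarrow> P y \<Longrightarrow> P (x + y)"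
    and "\<And>c x. x \<in> M \<Longrightarrow> P x \<Longrightarrow> P (scale c x)" and "P 0"
  shows "P w"
proof -
  have "subspace {x\<in>M. P x}"
    using assms(3-5) subspace_M unfolding subspace_def by auto
  moreover have "gens \<subseteq> {x\<in>M. P x}"
    using assms(2) unfolding M_def gens_def by (auto intro!: span_base)
  ultimately have "M \<subseteq> {x\<in>M. P x}"
    unfolding M_def using span_minimal by blast
  then show ?thesis using assms(1) by blast
qed

lemma S_in_M: "w \<in> M \<Longrightarrow> S k w \<in> M"
proof (induction w rule: M_induct)
  case (gen l g)
  have "S k (S l g) \<in> gens" using gen by (auto simp: S_S gens_def)
  then show ?case by (simp add: M_def span_base)
next
  case zero
  show ?case using S_scale[of k 0 0] subspace_M by (simp add: subspace_0)
qed (auto simp: S_add S_scale intro: subspace_M subspace_add subspace_scale)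

lemma invariant_M: "invariant M"
  by (simp add: invariant_def subspace_M S_in_M)

lemmas act_add = poly_act_add[where T = "S k", OF S_add S_scale]
  and act_scale = poly_act_scale[where T = "S k", OF S_add S_scale]
  and act_diff = poly_act_diff[where T = "S k", OF S_add S_scale]
  and act_mult = poly_act_mult[where T = "S k", OF S_add S_scale]
  and act_pCons = poly_act_pCons[where T = "S k", OF S_add S_scale]
  and act_zero = poly_act_zero[where T = "S k", OF S_add S_scale]
  and act_sum = poly_act_sum[where T = "S k", OF S_add S_scale]
  and act_sum_left = poly_act_sum_left[where T = "S k", OF S_add S_scale]
  and act_smult = poly_act_smult[where T = "S k", OF S_add S_scale]
  and act_commute = poly_act_commute[where T = "S k", OF S_add S_scale]
  and act_in_subspace = poly_act_in_subspace[where T = "S k", OF S_add S_scale]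
  and act_injective = poly_act_injective_modulo[where T = "S k", OF S_add S_scale]
  and act_eigenvector = poly_act_eigenvector_modulo[where T = "S k", OF S_add S_scale]
  for k

lemma S_poly_act: "S k (poly_act (S e) q w) = poly_act (S e) q (S k w)"
  by (rule act_commute) (auto simp: S_add S_scale S_commute)

lemma poly_act_invariant: "invariant N \<Longrightarrow> w \<in> N \<Longrightarrow> poly_act (S e) q w \<in> N"
  by (rule act_in_subspace) (auto simp: invariant_def)

text \<open>Polynomials in \<open>S e\<close> commute with all translations, so checking the
  generators in \<open>G\<close> is enough.\<close>

lemma invariant_contains_image:
  assumes "invariant N" "\<And>g. g \<in> G \<Longrightarrow> poly_act (S e) q g \<in> N" "w \<in> M"
  shows "poly_act (S e) q w \<in> N"
  using assms(3)
proof (induction w rule: M_induct)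
  case (gen k g)
  then have "S k (poly_act (S e) q g) \<in> N"
    using assms(1,2) by (simp add: invariant_def)
  then show ?case by (simp only: S_poly_act)
next
  case zero
  show ?case
    using assms(1) act_zero by (simp add: invariant_def subspace_0)
qed (use assms(1) in \<open>auto simp: act_add act_scale invariant_def intro: subspace_add subspace_scale\<close>)

text \<open>If \<open>U\<close> preserves \<open>N\<close>, this submodule corresponds to the kernel
  of \<open>U\<close> on M/N. It is used for q(S e) and for S k - l.\<close>

lemma invariant_preimage:
  assumes N: "invariant N"
    and "\<And>x y. U (x + y) = U x + U y" "\<And>c x. U (scale c x) = scale c (U x)"
    and "\<And>k x. U (S k x) = S k (U x)"
  shows "invariant {w\<in>M. U w \<in> N}"
proof -
  have sub: "subspace N" and NS: "\<And>k x. x \<in> N \<Longrightarrow> S k x \<in> N"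
    using N by (auto simp: invariant_def)
  have "U 0 = 0" using assms(3)[of 0 0] by simp
  then have "subspace {w\<in>M. U w \<in> N}"
    by (intro subspaceI)
      (simp_all add: assms(2,3) subspace_0 subspace_add subspace_scale sub subspace_M)
  then show ?thesis
    by (simp add: invariant_def S_in_M assms(4) NS)
qed

text \<open>If \<open>U\<close> preserves \<open>N\<close>, this submodule corresponds to the image
  of \<open>U\<close> on M/N. It is used for S k - l.\<close>

lemma invariant_image_sum:
  assumes N: "invariant N"
    and U: "\<And>x y. U (x + y) = U x + U y" "\<And>c x. U (scale c x) = scale c (U x)"
    and "\<And>k x. U (S k x) = S k (U x)" "\<And>x. x \<in> M \<Longrightarrow> U x \<in> M"
  shows "invariant {U w + x | w x. w \<in> M \<and> x \<in> N}" (is "invariant ?R")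
proof -
  have sub: "subspace N" "N \<subseteq> M" and NS: "\<And>k x. x \<in> N \<Longrightarrow> S k x \<in> N"
    using N by (auto simp: invariant_def)
  have "U 0 = 0" using U(2)[of 0 0] by simp
  have mem: "U w + x \<in> ?R" if "w \<in> M" "x \<in> N" for w x using that by blast
  have "subspace ?R"
  proof (rule subspaceI)
    show "0 \<in> ?R"
      using mem[of 0 0] \<open>U 0 = 0\<close> subspace_0[OF sub(1)] subspace_0[OF subspace_M] by simp
  next
    fix y z assume "y \<in> ?R" "z \<in> ?R"
    then obtain w x w' x' where *: "y = U w + x" "z = U w' + x'" "w \<in> M" "w' \<in> M" "x \<in> N" "x' \<in> N"
      by blast
    have "U (w + w') + (x + x') \<in> ?R"
      by (intro mem subspace_add sub subspace_M *)
    then show "y + z \<in> ?R" by (simp only: * U add_ac)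
  next
    fix c y assume "y \<in> ?R"
    then obtain w x where *: "y = U w + x" "w \<in> M" "x \<in> N"
      by blast
    have "U (scale c w) + scale c x \<in> ?R"
      by (intro mem subspace_scale sub subspace_M *)
    then show "scale c y \<in> ?R" by (simp only: * U scale_right_distrib)
  qed
  moreover have "?R \<subseteq> M"
    using sub subspace_M assms(5) subspace_add by blast
  moreover have "S k y \<in> ?R" if "y \<in> ?R" for k y
  proof -
    obtain w x where *: "y = U w + x" "w \<in> M" "x \<in> N" using \<open>y \<in> _\<close> by blast
    have "U (S k w) + S k x \<in> ?R"
      by (intro mem S_in_M NS *)
    then show ?thesis by (simp only: * S_add assms(4))
  qed
  ultimately show ?thesis unfolding invariant_def by blast
qed

section \<open>Maximal persisting submodules and scalar action on the quotient\<close>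

definition persists :: "'k \<Rightarrow> complex poly \<Rightarrow> 'b set \<Rightarrow> bool" where
  "persists e q N \<longleftrightarrow> (\<forall>n. \<exists>g\<in>G. poly_act (S e) (q ^ n) g \<notin> N)"

text \<open>Persistence is the statement that q does not act nilpotently on M/N. Since G is finite, it passes to
  unions of chains, so Zorn's lemma applies without any Noetherian hypothesis.\<close>

lemma exists_maximal_persisting:
  assumes "persists e q {0}"
  obtains N where "invariant N" "persists e q N"
    "\<forall>N'. invariant N' \<longrightarrow> N \<subseteq> N' \<longrightarrow> persists e q N' \<longrightarrow> N' = N"
proof -
  let ?A = "{N. invariant N \<and> persists e q N}"
  have "invariant {0}"
    using subspace_M S_scale[of _ 0 0] by (auto simp: invariant_def subspace_0 subspace_single_0)
  then have "?A \<noteq> {}" using assms by blast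
  moreover have "\<Union>\<C> \<in> ?A" if C: "\<C> \<noteq> {}" "subset.chain ?A \<C>" for \<C>
  proof -
    have inv: "\<And>N. N \<in> \<C> \<Longrightarrow> invariant N" and per: "\<And>N. N \<in> \<C> \<Longrightarrow> persists e q N"
      and ch: "\<And>X Y. X \<in> \<C> \<Longrightarrow> Y \<in> \<C> \<Longrightarrow> X \<subseteq> Y \<or> Y \<subseteq> X"
      using C(2) unfolding subset.chain_def by blast+
    have sub: "subspace (\<Union>\<C>)"
    proof (rule subspaceI)
      show "0 \<in> \<Union>\<C>"
        using C(1) inv unfolding invariant_def by (meson UnionI ex_in_conv subspace_0)
      show "scale c x \<in> \<Union>\<C>" if "x \<in> \<Union>\<C>" for c x
        using that inv unfolding invariant_def by (blast intro: subspace_scale)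
      show "x + y \<in> \<Union>\<C>" if xy: "x \<in> \<Union>\<C>" "y \<in> \<Union>\<C>" for x y
      proof -
        obtain X Y where XY: "X \<in> \<C>" "Y \<in> \<C>" "x \<in> X" "y \<in> Y" using xy by blast
        then obtain Z where "Z \<in> \<C>" "x \<in> Z" "y \<in> Z" using ch[of X Y] by blast
        then show ?thesis using inv unfolding invariant_def by (blast intro: subspace_add)
      qed
    qed
    have "persists e q (\<Union>\<C>)"
      unfolding persists_def
    proof (intro allI, rule ccontr)
      fix n assume "\<not> (\<exists>g\<in>G. poly_act (S e) (q ^ n) g \<notin> \<Union>\<C>)"
      then have "poly_act (S e) (q ^ n) ` G \<subseteq> \<Union>\<C>" by blast
      moreover have "finite (poly_act (S e) (q ^ n) ` G)" using finite_G by simp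
      ultimately obtain N where "N \<in> \<C>" "poly_act (S e) (q ^ n) ` G \<subseteq> N"
        using finite_subset_Union_chain C by metis
      then show False using per unfolding persists_def by blast
    qed
    moreover have "invariant (\<Union>\<C>)"
      using sub inv unfolding invariant_def by blast
    ultimately show ?thesis by blast
  qed
  ultimately obtain N where "N \<in> ?A" "\<forall>X\<in>?A. N \<subseteq> X \<longrightarrow> X = N"
    using subset_Zorn_nonempty[of ?A] by blast
  then show thesis by (intro that[of N]) auto
qed

text \<open>Dixmier's argument: uncountably many vectors \<open>(S k - l)\<^sup>-\<^sup>1 v\<close> in a space of countable
  dimension are linearly dependent, and clearing denominators gives a nonzero polynomial in S k
  that annihilates v.\<close>

lemma uncountable_resolvents_contradiction:
  fixes v :: "nat \<Rightarrow> 'b"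
  assumes N: "invariant N" and w: "\<And>l. w l \<in> M"
    and inj: "\<And>l x. x \<in> M \<Longrightarrow> S k x - scale l x \<in> N \<Longrightarrow> x \<in> N"
    and v: "\<And>n. v n \<in> M" "\<And>n. v n \<notin> N"
    and res: "\<And>l. \<exists>n. v n - (S k (w l) - scale l (w l)) \<in> N"
  shows False
proof -
  obtain n where n: "\<And>l. v (n l) - (S k (w l) - scale l (w l)) \<in> N"
    using res by metis
  have "\<exists>F. finite F \<and> F \<subseteq> gens \<and> w l \<in> span F" for l
  proof -
    have "w l \<in> span gens" using w by (simp add: M_def)
    then obtain F r where "finite F" "F \<subseteq> gens" "w l = (\<Sum>a\<in>F. scale (r a) a)"
      unfolding span_explicit by blast
    then show ?thesis
      by (intro exI[of _ F]) (auto intro!: span_sum span_scale intro: span_base)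
  qed
  then obtain F where F: "\<And>l. finite (F l)" "\<And>l. F l \<subseteq> gens" "\<And>l. w l \<in> span (F l)"
    by metis
  \<comment> \<open>Pigeonhole: the pairs \<open>?h l\<close> range over a countable set while
    \<open>l\<close> ranges over all complex numbers. So infinitely many \<open>w l\<close> share
    one target \<open>v m\<close> and lie in the span of one finite set.\<close>
  let ?h = "\<lambda>l. (n l, F l)"
  have "countable ((UNIV :: nat set) \<times> {A. finite A \<and> A \<subseteq> gens})"
    using countable_gens by (intro countable_SIGMA countable_Collect_finite_subset) auto
  moreover have "range ?h \<subseteq> (UNIV :: nat set) \<times> {A. finite A \<and> A \<subseteq> gens}"
    using F by auto
  ultimately have "countable (range ?h)"
    using countable_subset by blast
  moreover have "(UNIV :: complex set) = (\<Union>y\<in>range ?h. {l. ?h l = y})" by auto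
  ultimately have "\<exists>y\<in>range ?h. uncountable {l. ?h l = y}"
    using uncountable_UNIV_complex countable_UN[of "range ?h" "\<lambda>y. {l. ?h l = y}"] by metis
  then obtain m F0 where mF: "infinite {l. ?h l = (m, F0)}"
    using countable_finite by auto
  let ?L = "{l. ?h l = (m, F0)}"
  obtain l0 where "?h l0 = (m, F0)" using mF not_finite_existsD by auto
  then have "finite F0" using F(1) by auto
  moreover have "\<And>l. l \<in> ?L \<Longrightarrow> w l \<in> span F0" using F(3) by auto
  ultimately obtain A c where A: "finite A" "A \<subseteq> ?L" "\<exists>l\<in>A. c l \<noteq> 0"
      "(\<Sum>l\<in>A. scale (c l) (w l)) = 0"
    by (rule infinite_family_dependent[OF mF])
  \<comment> \<open>\<open>?r\<close> is the numerator of the rational function with partial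
    fractions c l / (X - l), l in \<open>A\<close>.\<close>
  let ?P = "\<lambda>l. \<Prod>j\<in>A - {l}. [:- j, 1:]"
  let ?r = "\<Sum>l\<in>A. smult (c l) (?P l)"
  obtain l1 where l1: "l1 \<in> A" "c l1 \<noteq> 0" using A(3) by blast
  \<comment> \<open>At \<open>l1\<close> every summand except the one for \<open>l1\<close> contains
    the factor l1 - l1, which shows that \<open>?r\<close> is not the zero polynomial.\<close>
  have "poly ?r l1 = (\<Sum>l\<in>A. c l * (\<Prod>j\<in>A - {l}. l1 - j))"
    by (simp add: poly_sum poly_prod)
  also have "\<dots> = c l1 * (\<Prod>j\<in>A - {l1}. l1 - j)"
  proof (subst sum.remove[OF A(1) l1(1)], subst sum.neutral)
    show "\<forall>l\<in>A - {l1}. c l * (\<Prod>j\<in>A - {l}. l1 - j) = 0"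
      using A(1) l1(1) by auto
  qed simp
  also have "\<dots> \<noteq> 0" using A(1) l1(2) by auto
  finally have "?r \<noteq> 0" by force
  have Nsub: "subspace N" using N by (simp add: invariant_def)
  \<comment> \<open>An exact identity: the resolvent terms cancel because the full product is
    \<open>?P l\<close> times X - l. Its first sum lies in \<open>N\<close> by the choice of
    \<open>w\<close>, and its last term vanishes by the linear relation.\<close>
  have "poly_act (S k) ?r (v m)
      = (\<Sum>l\<in>A. scale (c l) (poly_act (S k) (?P l) (v m - (S k (w l) - scale l (w l)))))
        + poly_act (S k) (\<Prod>j\<in>A. [:- j, 1:]) (\<Sum>l\<in>A. scale (c l) (w l))"
  proof -
    have "poly_act (S k) (\<Prod>j\<in>A. [:- j, 1:]) (w l)
        = poly_act (S k) (?P l) (S k (w l) - scale l (w l))" if "l \<in> A" for l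
    proof -
      have "(\<Prod>j\<in>A. [:- j, 1:]) = ?P l * [:- l, 1:]"
        by (subst prod.remove[OF A(1) that]) (simp add: mult.commute)
      then have "poly_act (S k) (\<Prod>j\<in>A. [:- j, 1:]) (w l)
        = poly_act (S k) (?P l) (poly_act (S k) [:- l, 1:] (w l))"
        by (simp only: act_mult)
      moreover have "poly_act (S k) [:- l, 1:] (w l) = S k (w l) - scale l (w l)"
        using S_scale[of k 0 0] by (simp add: act_pCons S_add)
      ultimately show ?thesis by simp
    qed
    then have "poly_act (S k) (\<Prod>j\<in>A. [:- j, 1:]) (\<Sum>l\<in>A. scale (c l) (w l))
      = (\<Sum>l\<in>A. scale (c l) (poly_act (S k) (?P l) (S k (w l) - scale l (w l))))"
      by (simp add: act_sum act_scale)
    then show ?thesis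
      by (simp add: act_sum_left act_smult
          sum.distrib[symmetric] scale_right_distrib[symmetric] act_add[symmetric])
  qed
  also have "\<dots> \<in> N"
  proof -
    have "v m - (S k (w l) - scale l (w l)) \<in> N" if "l \<in> A" for l
      using n[of l] A(2) that by auto
    then have "(\<Sum>l\<in>A. scale (c l) (poly_act (S k) (?P l) (v m - (S k (w l) - scale l (w l))))) \<in> N"
      using Nsub N by (intro subspace_sum subspace_scale poly_act_invariant) auto
    then show ?thesis
      using A(4) act_zero by simp
  qed
  finally have "poly_act (S k) ?r (v m) \<in> N" .
  then have "v m \<in> N"
    by (rule act_injective[OF subspace_M _ Nsub _ \<open>?r \<noteq> 0\<close> v(1), rotated -1])
      (use S_in_M inj in blast)+
  then show False using v(2) by blast
qed

text \<open>A substitute for Schur's lemma. A nonzero submodule of M/N is only known to contain the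
  image of a power of q(S e), but q(S e) is injective on M/N and commutes with translations, which
  makes up for the difference. Hence S k - l is either zero or injective on M/N, and injectivity for
  every l is excluded by the resolvent argument.\<close>

theorem exists_scalar_quotient:
  assumes "\<And>n. \<exists>g\<in>G. poly_act (S e) (q ^ n) g \<noteq> 0"
  obtains N \<xi> where "invariant N" "N \<noteq> M" "\<And>k w. w \<in> M \<Longrightarrow> S k w - scale (\<xi> k) w \<in> N"
    "poly q (\<xi> e) \<noteq> 0"
proof -
  have "persists e q {0}" using assms by (auto simp: persists_def)
  then obtain N where N: "invariant N" "persists e q N"
    and max: "\<forall>N'. invariant N' \<longrightarrow> N \<subseteq> N' \<longrightarrow> persists e q N' \<longrightarrow> N' = N"
    by (rule exists_maximal_persisting)
  have Nsub: "subspace N" and NM: "N \<subseteq> M" and NS: "\<And>k x. x \<in> N \<Longrightarrow> S k x \<in> N"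
    using N(1) by (auto simp: invariant_def)
  \<comment> \<open>Maximality read backwards: a strictly larger submodule no longer persists, so it
    absorbs some power of q(S e).\<close>
  have larger: "\<exists>n. \<forall>w\<in>M. poly_act (S e) (q ^ n) w \<in> N'"
    if "invariant N'" "N \<subseteq> N'" "N' \<noteq> N" for N'
    using that max[rule_format, of N'] invariant_contains_image[of N' e] unfolding persists_def by metis
  \<comment> \<open>A nonzero kernel of q(S e) on M/N would absorb q^n, and then q^(n+1) would map
    \<open>G\<close> into \<open>N\<close>, against persistence.\<close>
  have qinj: "w \<in> N" if "w \<in> M" "poly_act (S e) q w \<in> N" for w
  proof (rule ccontr)
    assume "w \<notin> N"
    let ?N' = "{w\<in>M. poly_act (S e) q w \<in> N}"
    have "invariant ?N'"
      by (rule invariant_preimage[OF N(1)]) (auto simp: act_add act_scale S_poly_act)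
    moreover have "N \<subseteq> ?N'" using NM poly_act_invariant[OF N(1)] by blast
    moreover have "?N' \<noteq> N" using that \<open>w \<notin> N\<close> by blast
    ultimately obtain n where "\<forall>w\<in>M. poly_act (S e) (q ^ n) w \<in> ?N'"
      using larger by blast
    then have "poly_act (S e) (q ^ Suc n) g \<in> N" if "g \<in> G" for g
      using that G_subset_M by (auto simp: act_mult)
    then show False using N(2) unfolding persists_def by blast
  qed
  have qinj_pow: "w \<in> N" if "w \<in> M" "poly_act (S e) (q ^ n) w \<in> N" for w n
    using that(2)
  proof (induction n)
    case 0
    then show ?case by (simp add: poly_act_def)
  next
    case (Suc n)
    have "poly_act (S e) q (poly_act (S e) (q ^ n) w) \<in> N"
      using Suc.prems by (simp add: act_mult)
    then show ?case
      using Suc.IH qinj poly_act_invariant[OF invariant_M that(1)] by blast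
  qed
  obtain g where g: "g \<in> M" "g \<notin> N"
    using N(2) G_subset_M unfolding persists_def by (metis poly_act_invariant[OF N(1)] subsetD)
  have "\<exists>l. \<forall>w\<in>M. S k w - scale l w \<in> N" for k
  proof (rule ccontr)
    assume no: "\<nexists>l. \<forall>w\<in>M. S k w - scale l w \<in> N"
    \<comment> \<open>A nonzero eigenspace for \<open>l\<close> absorbs q^n. Cancelling the
      injective q^n makes S k act as \<open>l\<close> on all of M/N, which \<open>no\<close>
      forbids.\<close>
    have inj: "x \<in> N" if "x \<in> M" "S k x - scale l x \<in> N" for l x
    proof (rule ccontr)
      assume "x \<notin> N"
      let ?N' = "{w\<in>M. S k w - scale l w \<in> N}"
      have "invariant ?N'"
        by (rule invariant_preimage[OF N(1)])
          (auto simp: S_add S_scale S_diff S_commute scale_right_distrib scale_right_diff_distrib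
            mult.commute[of l])
      moreover have "N \<subseteq> ?N'" using NM NS Nsub by (auto intro: subspace_diff subspace_scale)
      moreover have "?N' \<noteq> N" using that \<open>x \<notin> N\<close> by blast
      ultimately obtain n where n: "\<forall>w\<in>M. poly_act (S e) (q ^ n) w \<in> ?N'"
        using larger by blast
      have "S k w - scale l w \<in> N" if "w \<in> M" for w
      proof (rule qinj_pow)
        show "S k w - scale l w \<in> M"
          using that S_in_M subspace_M by (intro subspace_diff subspace_scale) auto
        show "poly_act (S e) (q ^ n) (S k w - scale l w) \<in> N"
          using n that by (simp add: act_diff act_scale S_poly_act)
      qed
      then show False using no by blast
    qed
    \<comment> \<open>By injectivity, S k - l does not send \<open>g\<close> into \<open>N\<close>,
      so its image in M/N is nonzero and contains q^n applied to \<open>g\<close>. The exponent may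
      depend on \<open>l\<close>, which is why the resolvent lemma allows a sequence
      \<open>v\<close>.\<close>
    have "\<exists>w n. w \<in> M \<and> poly_act (S e) (q ^ n) g - (S k w - scale l w) \<in> N" for l
    proof -
      let ?U = "\<lambda>w. S k w - scale l w"
      let ?N' = "{?U w + x | w x. w \<in> M \<and> x \<in> N}"
      have "invariant ?N'"
        by (rule invariant_image_sum[OF N(1)])
          (auto simp: S_add S_scale S_diff S_commute scale_right_distrib scale_right_diff_distrib
            mult.commute[of l] intro!: subspace_diff[OF subspace_M] subspace_scale[OF subspace_M] S_in_M)
      moreover have mem: "?U w + x \<in> ?N'" if "w \<in> M" "x \<in> N" for w x
        using that by blast
      moreover have "N \<subseteq> ?N'"
        using mem[of 0] S_scale[of k 0 0] subspace_0[OF subspace_M] by auto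
      moreover have "?N' \<noteq> N"
        using mem[OF g(1) subspace_0[OF Nsub]] inj[OF g(1), of l] g(2) by auto
      ultimately obtain n where "\<forall>w\<in>M. poly_act (S e) (q ^ n) w \<in> ?N'"
        using larger by blast
      then obtain w x where "w \<in> M" "x \<in> N" "poly_act (S e) (q ^ n) g = ?U w + x"
        using g(1) by blast
      then show ?thesis by (intro exI[of _ w] exI[of _ n]) simp
    qed
    then obtain w where w: "\<And>l. w l \<in> M"
      "\<And>l. \<exists>n. poly_act (S e) (q ^ n) g - (S k (w l) - scale l (w l)) \<in> N"
      by metis
    show False
      by (rule uncountable_resolvents_contradiction[OF N(1) w(1) inj _ _ w(2)])
        (use g qinj_pow poly_act_invariant[OF invariant_M] in auto)
  qed
  then obtain \<xi> where \<xi>: "\<And>k w. w \<in> M \<Longrightarrow> S k w - scale (\<xi> k) w \<in> N" by metis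
  \<comment> \<open>Modulo \<open>N\<close>, q(S e) multiplies \<open>g\<close> by this number, and
    it is injective there.\<close>
  have "poly q (\<xi> e) \<noteq> 0"
  proof
    assume "poly q (\<xi> e) = 0"
    then have "poly_act (S e) q g \<in> N"
      using act_eigenvector[OF Nsub NS \<xi>[OF g(1)], of e q] by simp
    then show False using qinj g by blast
  qed
  then show thesis using N(1) g \<xi> by (intro that[of N \<xi>]) auto
qed

end

section \<open>Linear recurrences on \<int> and on integer lattices\<close>

lemma recurrence_int_zero:
  fixes f :: "int \<Rightarrow> complex" and c :: "nat \<Rightarrow> complex"
  assumes c: "c 0 \<noteq> 0" "c D \<noteq> 0"
    and rec: "\<And>n. (\<Sum>t\<le>D. c t * f (n + int t)) = 0"
    and init: "\<And>n. 0 \<le> n \<Longrightarrow> n < int D \<Longrightarrow> f n = 0"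
  shows "f n = 0"
proof -
  \<comment> \<open>Upwards, the recurrence is solved for its top term, using that
    \<open>c D\<close> is nonzero.\<close>
  have up: "f (int n) = 0" for n
  proof (induction n rule: less_induct)
    case (less n)
    show ?case
    proof (cases "n < D")
      case True
      then show ?thesis using init by simp
    next
      case False
      have "(\<Sum>t<D. c t * f (int (n - D) + int t)) = 0"
      proof (intro sum.neutral ballI)
        fix t assume "t \<in> {..<D}"
        then have "f (int (n - D + t)) = 0" using False by (intro less.IH) auto
        then show "c t * f (int (n - D) + int t) = 0" by (simp only: of_nat_add mult_zero_right)
      qed
      then have "c D * f (int (n - D) + int D) = 0"
        using rec[of "int (n - D)"] unfolding lessThan_Suc_atMost[symmetric] sum.lessThan_Suc by simp
      then show ?thesis using c False by simp
    qed
  qed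
  \<comment> \<open>Downwards, it is solved for its bottom term, using that \<open>c 0\<close> is
    nonzero.\<close>
  have "f (- int n) = 0" for n
  proof (induction n rule: less_induct)
    case (less n)
    have zero: "f (- int n + int t) = 0" if "t > 0" for t
    proof (cases "t < n")
      case True
      then have "- int n + int t = - int (n - t)" by simp
      then show ?thesis using less.IH[of "n - t"] that True by simp
    next
      case False
      then have "- int n + int t = int (t - n)" by simp
      then show ?thesis by (simp only: up)
    qed
    have "(\<Sum>t\<le>D. c t * f (- int n + int t)) = (\<Sum>t\<in>{0}. c t * f (- int n + int t))"
      by (rule sum.mono_neutral_right) (use zero in auto)
    then show ?case using rec[of "- int n"] c by simp
  qed
  with up show ?thesis by (cases n rule: int_cases2) auto
qed

text \<open>The box is widened one direction at a time: \<open>A\<close> holds the coordinates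
  already free of bounds, and a new coordinate is freed by the one-dimensional recurrence along
  lines in that direction.\<close>

lemma recurrence_vec_zero:
  fixes f :: "int^'d \<Rightarrow> complex" and c :: "'d \<Rightarrow> nat \<Rightarrow> complex"
  assumes c: "\<And>i. c i 0 \<noteq> 0" "\<And>i. c i (D i) \<noteq> 0"
    and rec: "\<And>k i. (\<Sum>t\<le>D i. c i t * f (k + axis i (int t))) = 0"
    and init: "\<And>k. \<forall>i. 0 \<le> k $ i \<and> k $ i < int (D i) \<Longrightarrow> f k = 0"
  shows "f k = 0"
proof -
  have "\<forall>k. (\<forall>i. i \<notin> A \<longrightarrow> 0 \<le> k $ i \<and> k $ i < int (D i)) \<longrightarrow> f k = 0" if "finite A" for A
    using that
  proof (induction A rule: finite_induct)
    case empty
    then show ?case using init by auto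
  next
    case (insert i A)
    show ?case
    proof (intro allI impI)
      fix k :: "int^'d" assume k: "\<forall>j. j \<notin> insert i A \<longrightarrow> 0 \<le> k $ j \<and> k $ j < int (D j)"
      have "f (k + axis i (k $ i - k $ i)) = 0"
      \<comment> \<open>The line through \<open>k\<close> is parametrised by the value
        \<open>n\<close> of its i-th coordinate: the initial window is covered by the induction
        hypothesis, and n = \<open>k $ i\<close> returns \<open>k\<close>.\<close>
      proof (rule recurrence_int_zero[of "c i" "D i" "\<lambda>n. f (k + axis i (n - k $ i))"])
        fix n :: int
        show "(\<Sum>t\<le>D i. c i t * f (k + axis i (n + int t - k $ i))) = 0"
        proof -
          have "k + axis i (n + int t - k $ i) = k + axis i (n - k $ i) + axis i (int t)" for t
            by (simp add: vec_eq_iff axis_def)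
          then show ?thesis using rec[of i "k + axis i (n - k $ i)"] by (simp only:)
        qed
        assume "0 \<le> n" "n < int (D i)"
        then show "f (k + axis i (n - k $ i)) = 0"
          using insert.IH k by (auto simp: axis_def)
      qed (use c in auto)
      moreover have "k + axis i (k $ i - k $ i) = k" by (simp add: vec_eq_iff axis_def)
      ultimately show "f k = 0" by (simp only:)
    qed
  qed
  from this[of UNIV] show ?thesis by simp
qed

lemma finite_int_box: "finite {k :: int^'d. \<forall>i. 0 \<le> k $ i \<and> k $ i < int (D i)}"
proof (rule finite_subset)
  show "{k :: int^'d. \<forall>i. 0 \<le> k $ i \<and> k $ i < int (D i)}
      \<subseteq> vec_lambda ` (PiE UNIV (\<lambda>i. {0..<int (D i)}))"
  proof
    fix k :: "int^'d" assume "k \<in> {k. \<forall>i. 0 \<le> k $ i \<and> k $ i < int (D i)}"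
    then have "vec_nth k \<in> PiE UNIV (\<lambda>i. {0..<int (D i)})" by auto
    then show "k \<in> vec_lambda ` (PiE UNIV (\<lambda>i. {0..<int (D i)}))"
      by (metis image_eqI vec_nth_inverse)
  qed
  show "finite (vec_lambda ` (PiE (UNIV :: 'd set) (\<lambda>i. {0..<int (D i)})))"
    by (intro finite_imageI finite_PiE) auto
qed

section \<open>Monomials as characters of the translation group\<close>

lemma zmono_add: "(\<And>i. z $ i \<noteq> 0) \<Longrightarrow> zmono z (k + l) = zmono z k * zmono z l"
  by (simp add: zmono_def power_int_add prod.distrib)

lemma zmono_0 [simp]: "zmono z 0 = 1"
  by (simp add: zmono_def)

lemma zmono_inverse_uminus: "zmono (\<chi> i. inverse (z $ i)) (- k) = zmono z k"
  by (simp add: zmono_def power_int_minus power_int_inverse)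

lemma zmono_axis: "zmono z (axis i 1) = z $ i"
proof -
  have "zmono z (axis i 1) = (\<Prod>j\<in>UNIV. if j = i then z $ i else 1)"
    unfolding zmono_def by (rule prod.cong) (auto simp: axis_def)
  then show ?thesis by simp
qed

text \<open>A character is determined by its values on the unit vectors, which are invertible
  because \<xi> k * \<xi> (- k) = 1. This turns the scalars of a quotient module into a point with
  nonzero coordinates.\<close>

lemma character_eq_zmono:
  fixes \<xi> :: "int^'d \<Rightarrow> complex"
  assumes "\<xi> 0 = 1" and add: "\<And>k l. \<xi> (k + l) = \<xi> k * \<xi> l"
  shows "\<xi> k = zmono (\<chi> i. \<xi> (axis i 1)) k" "\<xi> (axis i 1) \<noteq> 0"
proof -
  have inv: "\<xi> k * \<xi> (- k) = 1" for k
    using add[of k "- k"] assms(1) by simp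
  then show nz: "\<xi> (axis i 1) \<noteq> 0" for i
    by (metis mult_zero_left zero_neq_one)
  have nat: "\<xi> (axis i (int n)) = \<xi> (axis i 1) ^ n" for i n
  proof (induction n)
    case 0
    then show ?case using assms(1) by (simp add: axis_def zero_vec_def[symmetric] cong: if_cong)
  next
    case (Suc n)
    have "(axis i (int (Suc n)) :: int^'d) = axis i 1 + axis i (int n)"
      by (simp add: vec_eq_iff axis_def)
    then show ?case using Suc add by simp
  qed
  have int: "\<xi> (axis i n) = \<xi> (axis i 1) powi n" for i n
  proof (cases n rule: int_cases2)
    case (nonneg m)
    then show ?thesis using nat by simp
  next
    case (nonpos m)
    have "(axis i n :: int^'d) = - axis i (int m)"
      using nonpos by (simp add: vec_eq_iff axis_def)
    then have "\<xi> (axis i n) = inverse (\<xi> (axis i (int m)))"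
      using inv[of "axis i (int m)"] by (simp add: inverse_unique)
    then show ?thesis using nat nonpos by (simp add: power_int_minus)
  qed
  have "\<xi> (\<Sum>i\<in>A. axis i (k $ i)) = (\<Prod>i\<in>A. \<xi> (axis i (k $ i)))" if "finite A" for A
    using that by (induction A rule: finite_induct) (auto simp: assms)
  moreover have "k = (\<Sum>i\<in>UNIV. axis i (k $ i))"
    by (simp add: vec_eq_iff axis_def)
  ultimately have "\<xi> k = (\<Prod>i\<in>UNIV. \<xi> (axis i (k $ i)))"
    using finite by metis
  also have "\<dots> = (\<Prod>i\<in>UNIV. \<xi> (axis i 1) powi (k $ i))"
    by (intro prod.cong refl int)
  finally show "\<xi> k = zmono (\<chi> i. \<xi> (axis i 1)) k"
    by (simp add: zmono_def)
qed

section \<open>Crystal frameworks, motifs and the free translation action\<close>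

interpretation flex: complex_space "flex_scale :: complex \<Rightarrow> ('v \<Rightarrow> complex^'d) \<Rightarrow> _"
  by unfold_locales (auto simp: flex_scale_def fun_eq_iff vec_eq_iff algebra_simps)

lemma sum_fun_apply: "(\<Sum>a\<in>A. f a) x = (\<Sum>a\<in>A. f a x)"
  for f :: "'i \<Rightarrow> 'x \<Rightarrow> 'y::comm_monoid_add"
  by (induction A rule: infinite_finite_induct) auto

locale crystal =
  fixes V :: "'v set" and E :: "'v set set" and p :: "'v \<Rightarrow> real^'d"
    and act :: "int^'d \<Rightarrow> 'v \<Rightarrow> 'v" and a :: "'d \<Rightarrow> real^'d"
    and Fv :: "'v set" and Fe :: "('v \<times> 'v) set"
  assumes framework: "crystal_framework V E p act a"
    and motif: "motif V E act Fv Fe"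
begin

abbreviation "F \<equiv> flex_space V E p"

lemma act_in_V: "x \<in> V \<Longrightarrow> act k x \<in> V"
  using framework unfolding crystal_framework_def bij_betw_def by blast

lemma act_0: "x \<in> V \<Longrightarrow> act 0 x = x"
  using framework unfolding crystal_framework_def by blast

lemma act_add: "x \<in> V \<Longrightarrow> act (k + l) x = act k (act l x)"
  using framework unfolding crystal_framework_def by blast

lemma p_act: "x \<in> V \<Longrightarrow> p (act k x) = p x + (\<Sum>i\<in>UNIV. real_of_int (k $ i) *\<^sub>R a i)"
  using framework unfolding crystal_framework_def by blast

lemma p_act_diff: "x \<in> V \<Longrightarrow> y \<in> V \<Longrightarrow> p (act k x) $ i - p (act k y) $ i = p x $ i - p y $ i"
  by (simp add: p_act)

lemma edge_act: "x \<in> V \<Longrightarrow> y \<in> V \<Longrightarrow> {act k x, act k y} \<in> E \<longleftrightarrow> {x, y} \<in> E"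
  using framework unfolding crystal_framework_def by blast

lemma edge_in_V: "{x, y} \<in> E \<Longrightarrow> x \<in> V \<and> y \<in> V"
  using framework unfolding crystal_framework_def by (auto simp: doubleton_eq_iff)

text \<open>The placements of the two translates differ by an integer combination of the independent
  period vectors. Freeness is what makes \<open>motif_shift\<close> well defined.\<close>

lemma act_free:
  assumes "x \<in> V" "act k x = act l x"
  shows "k = l"
proof -
  have "inj a" "independent (range a)"
    using framework unfolding crystal_framework_def by blast+
  have "(\<Sum>i\<in>UNIV. real_of_int (k $ i) *\<^sub>R a i) = (\<Sum>i\<in>UNIV. real_of_int (l $ i) *\<^sub>R a i)"
    using p_act[OF assms(1), of k] p_act[OF assms(1), of l] assms(2) by simp
  then have "(\<Sum>i\<in>UNIV. real_of_int (k $ i - l $ i) *\<^sub>R a i) = 0"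
    by (simp add: scaleR_diff_left sum_subtractf)
  then have sum0: "(\<Sum>w\<in>range a. real_of_int (k $ inv a w - l $ inv a w) *\<^sub>R w) = 0"
    using \<open>inj a\<close> by (simp add: sum.reindex)
  have "real_of_int (k $ inv a (a i) - l $ inv a (a i)) = 0" for i
    using \<open>independent (range a)\<close>
    by (rule independentD[where u = "\<lambda>w. real_of_int (k $ inv a w - l $ inv a w)", OF _ _ _ sum0]) auto
  then show ?thesis using \<open>inj a\<close> by (simp add: vec_eq_iff)
qed

lemma Fv_subset: "Fv \<subseteq> V"
  and rep_ball: "\<forall>x\<in>V. \<exists>!v. v \<in> Fv \<and> (\<exists>k. act k v = x)"
  and Fe_ball: "\<forall>(x, y)\<in>Fe. {x, y} \<in> E"
  and edge_ball: "\<forall>e\<in>E. \<exists>!f. f \<in> (\<lambda>(x, y). {x, y}) ` Fe \<and> (\<exists>k. e = act k ` f)"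
  using motif unfolding motif_def by - (elim conjE, assumption)+

lemmas rep_ex1 = rep_ball[rule_format] and edge_ex1 = edge_ball[rule_format]

lemma rep_unique:
  assumes "v \<in> Fv" "w \<in> Fv" "act k v = act l w"
  shows "v = w"
proof -
  have "act k v \<in> V" using assms(1) Fv_subset act_in_V by blast
  note ex1 = rep_ex1[OF this]
  have "(THE v'. v' \<in> Fv \<and> (\<exists>k'. act k' v' = act k v)) = v"
    by (rule the1_equality[OF ex1]) (use assms in blast)
  moreover have "(THE v'. v' \<in> Fv \<and> (\<exists>k'. act k' v' = act k v)) = w"
    by (rule the1_equality[OF ex1]) (use assms in metis)
  ultimately show ?thesis by simp
qed

lemma rep_exists:
  assumes "x \<in> V" obtains v k where "v \<in> Fv" "x = act k v"
  using ex1_implies_ex[OF rep_ex1[OF assms]] that by blast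

lemma motif_vertex_act:
  assumes "v \<in> Fv" shows "motif_vertex act Fv (act k v) = v"
  unfolding motif_vertex_def
proof (rule the_equality)
  show "v \<in> Fv \<and> (\<exists>l. act l v = act k v)" using assms by blast
  show "w = v" if "w \<in> Fv \<and> (\<exists>l. act l w = act k v)" for w
    using that rep_unique assms by blast
qed

lemma motif_shift_act:
  assumes "v \<in> Fv" shows "motif_shift act Fv (act k v) = k"
  unfolding motif_shift_def motif_vertex_act[OF assms]
proof (rule the_equality)
  show "l = k" if "act l v = act k v" for l
    using that act_free assms Fv_subset by blast
qed simp

text \<open>Distinct representatives have distinct orbits, and there are finitely many vertex
  orbits.\<close>

lemma finite_Fv: "finite Fv"
proof (rule inj_on_finite)
  show "inj_on (\<lambda>x. {act k x | k. True}) Fv"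
  proof (rule inj_onI)
    fix v w assume vw: "v \<in> Fv" "w \<in> Fv" "{act k v | k. True} = {act k w | k. True}"
    then have "act 0 v \<in> {act k w | k. True}" by blast
    then show "v = w" using vw rep_unique by blast
  qed
  show "(\<lambda>x. {act k x | k. True}) ` Fv \<subseteq> {{act k x | k. True} | x. x \<in> V}"
    using Fv_subset by blast
  show "finite {{act k x | k. True} | x. x \<in> V}"
    using framework unfolding crystal_framework_def by blast
qed

lemma Fe_in_E: "(x, y) \<in> Fe \<Longrightarrow> {x, y} \<in> E"
  using Fe_ball by blast

lemma edge_rep:
  assumes "{x, y} \<in> E"
  obtains x' y' k where "(x', y') \<in> Fe"
    "x = act k x' \<and> y = act k y' \<or> x = act k y' \<and> y = act k x'"
proof -
  obtain f k where "f \<in> (\<lambda>(x, y). {x, y}) ` Fe" "{x, y} = act k ` f"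
    using ex1_implies_ex[OF edge_ex1[OF assms]] by (elim exE conjE) (rule that)
  then obtain x' y' where "(x', y') \<in> Fe" "{x, y} = {act k x', act k y'}" by auto
  then show thesis using that by (auto simp: doubleton_eq_iff)
qed

section \<open>Equivariant flexes and the spectrum\<close>

definition strain :: "('v \<Rightarrow> complex^'d) \<Rightarrow> 'v \<Rightarrow> 'v \<Rightarrow> complex" where
  "strain u x y = (\<Sum>i\<in>UNIV. (u x $ i - u y $ i) * complex_of_real (p x $ i - p y $ i))"

lemma F_iff: "u \<in> F \<longleftrightarrow> (\<forall>x. x \<notin> V \<longrightarrow> u x = 0) \<and> (\<forall>x y. {x, y} \<in> E \<longrightarrow> strain u x y = 0)"
  by (simp add: flex_space_def strain_def)

lemma strain_commute: "strain u x y = strain u y x"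
  unfolding strain_def by (rule sum.cong) (auto simp: algebra_simps)

text \<open>For a flex, this is factor-periodicity with multiplier \<omega>: a simultaneous
  eigenvector of all translations.\<close>

definition equivariant :: "complex^'d \<Rightarrow> ('v \<Rightarrow> complex^'d) \<Rightarrow> bool" where
  "equivariant \<omega> u \<longleftrightarrow> (\<forall>k. \<forall>x\<in>V. u (act k x) = zmono \<omega> k *s u x)"

text \<open>Only the columns of the two motif vertices contribute; if these coincide, the two terms
  add up. The right side has the shape of \<open>strain\<close> for the equivariant extension of
  \<open>u\<close>.\<close>

lemma transfer_fn_sum:
  assumes "x \<in> V" "y \<in> V"
  shows "(\<Sum>c\<in>Fv \<times> UNIV. transfer_fn p act Fv z (x, y) c * u c)
    = (\<Sum>i\<in>UNIV. (zmono z (- motif_shift act Fv x) * u (motif_vertex act Fv x, i)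
         - zmono z (- motif_shift act Fv y) * u (motif_vertex act Fv y, i))
         * complex_of_real (p x $ i - p y $ i))"
proof -
  have mv: "motif_vertex act Fv x \<in> Fv" if "x \<in> V" for x
    using that by (metis rep_exists motif_vertex_act)
  have "(\<Sum>c\<in>Fv \<times> UNIV. transfer_fn p act Fv z (x, y) c * u c)
    = (\<Sum>i\<in>UNIV. \<Sum>v\<in>Fv. transfer_fn p act Fv z (x, y) (v, i) * u (v, i))"
    by (subst sum.swap) (simp add: sum.cartesian_product case_prod_unfold)
  also have "\<dots> = (\<Sum>i\<in>UNIV. \<Sum>v\<in>Fv.
      (if v = motif_vertex act Fv x
        then complex_of_real (p x $ i - p y $ i) * zmono z (- motif_shift act Fv x) * u (v, i) else 0)
    - (if v = motif_vertex act Fv y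
        then complex_of_real (p x $ i - p y $ i) * zmono z (- motif_shift act Fv y) * u (v, i) else 0))"
    by (intro sum.cong refl) (auto simp: transfer_fn_def Let_def algebra_simps)
  also have "\<dots> = (\<Sum>i\<in>UNIV. (zmono z (- motif_shift act Fv x) * u (motif_vertex act Fv x, i)
         - zmono z (- motif_shift act Fv y) * u (motif_vertex act Fv y, i))
         * complex_of_real (p x $ i - p y $ i))"
    using mv assms finite_Fv by (simp add: sum_subtractf sum.delta' algebra_simps)
  finally show ?thesis .
qed

lemma equivariant_strain:
  assumes "equivariant \<omega> u" "x \<in> V" "y \<in> V"
  shows "strain u (act k x) (act k y) = zmono \<omega> k * strain u x y"
  using assms unfolding equivariant_def strain_def
  by (simp add: p_act_diff sum_distrib_left algebra_simps)

text \<open>Kernel vectors are the motif values of equivariant flexes. The inverse of \<omega> and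
  the negative exponents in the transfer function cancel to \<open>zmono \<omega> k\<close>, so a
  row of the kernel equation is the strain of a motif edge.\<close>

lemma spectrum_iff:
  "\<omega> \<in> flex_spectrum p act Fv Fe \<longleftrightarrow>
     (\<forall>i. \<omega> $ i \<noteq> 0) \<and> (\<exists>u\<in>F. u \<noteq> 0 \<and> equivariant \<omega> u)"
proof
  assume "\<omega> \<in> flex_spectrum p act Fv Fe"
  then obtain u where nz: "\<And>i. \<omega> $ i \<noteq> 0" and u: "\<exists>c\<in>Fv \<times> UNIV. u c \<noteq> 0"
    and ker: "\<forall>e\<in>Fe. (\<Sum>c\<in>Fv \<times> UNIV. transfer_fn p act Fv (\<chi> i. inverse (\<omega> $ i)) e c * u c) = 0"
    unfolding flex_spectrum_def by blast
  \<comment> \<open>The equivariant extension of the motif values \<open>u\<close> to all of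
    \<open>V\<close>.\<close>
  define w where "w x = (if x \<in> V then \<chi> i. zmono \<omega> (motif_shift act Fv x) * u (motif_vertex act Fv x, i) else 0)" for x
  have w_rep: "w (act k v) $ i = zmono \<omega> k * u (v, i)" if "v \<in> Fv" for k v i
    using that act_in_V Fv_subset by (auto simp: w_def motif_vertex_act motif_shift_act)
  have "equivariant \<omega> w"
    unfolding equivariant_def
  proof (intro allI ballI)
    fix k x assume "x \<in> V"
    then obtain v l where "v \<in> Fv" "x = act l v" by (rule rep_exists)
    then show "w (act k x) = zmono \<omega> k *s w x"
      using Fv_subset w_rep by (auto simp: vec_eq_iff act_add[symmetric] zmono_add nz)
  qed
  moreover have "w \<in> F"
    unfolding F_iff
  proof (intro conjI allI impI)
    fix x y assume "{x, y} \<in> E"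
    then obtain x' y' k where e: "(x', y') \<in> Fe"
      "x = act k x' \<and> y = act k y' \<or> x = act k y' \<and> y = act k x'"
      by (rule edge_rep)
    have V: "x' \<in> V" "y' \<in> V" using e(1) Fe_in_E edge_in_V by blast+
    then have "strain w x' y' = 0"
      using ker e(1) by (force simp: transfer_fn_sum zmono_inverse_uminus strain_def w_def)
    then show "strain w x y = 0"
      using e(2) equivariant_strain[OF \<open>equivariant \<omega> w\<close>] V strain_commute by auto
  qed (simp add: w_def)
  moreover have "w \<noteq> 0"
  proof -
    obtain v i where "v \<in> Fv" "u (v, i) \<noteq> 0" using u by auto
    then have "w (act 0 v) $ i \<noteq> 0" by (simp add: w_rep)
    then show ?thesis by auto
  qed
  ultimately show "(\<forall>i. \<omega> $ i \<noteq> 0) \<and> (\<exists>u\<in>F. u \<noteq> 0 \<and> equivariant \<omega> u)"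
    using nz by blast
next
  assume "(\<forall>i. \<omega> $ i \<noteq> 0) \<and> (\<exists>u\<in>F. u \<noteq> 0 \<and> equivariant \<omega> u)"
  then obtain w where nz: "\<forall>i. \<omega> $ i \<noteq> 0" and w: "w \<in> F" "w \<noteq> 0" "equivariant \<omega> w"
    by blast
  have rep: "zmono \<omega> (motif_shift act Fv x) * w (motif_vertex act Fv x) $ i = w x $ i" if "x \<in> V" for x i
  proof -
    obtain v l where "v \<in> Fv" "x = act l v" using \<open>x \<in> V\<close> by (rule rep_exists)
    then show ?thesis
      using w(3) Fv_subset by (auto simp: equivariant_def motif_vertex_act motif_shift_act)
  qed
  have "\<exists>c\<in>Fv \<times> UNIV. (case c of (v, i) \<Rightarrow> w v $ i) \<noteq> 0"
  proof (rule ccontr)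
    assume "\<not> ?thesis"
    then have "w v = 0" if "v \<in> Fv" for v using that by (auto simp: vec_eq_iff)
    then have "w (act k v) = 0" if "v \<in> Fv" for k v
      using that w(3) Fv_subset by (auto simp: equivariant_def)
    then have "w x = 0" for x
      using w(1) by (cases "x \<in> V") (auto simp: F_iff elim: rep_exists)
    then show False using w(2) by (simp add: fun_eq_iff)
  qed
  moreover have "(\<Sum>c\<in>Fv \<times> UNIV. transfer_fn p act Fv (\<chi> i. inverse (\<omega> $ i)) e c
      * (case c of (v, i) \<Rightarrow> w v $ i)) = 0" if eF: "e \<in> Fe" for e
  proof -
    obtain x y where e: "e = (x, y)" "{x, y} \<in> E" using Fe_in_E eF by (cases e) auto
    then have "strain w x y = 0" "x \<in> V" "y \<in> V" using w(1) F_iff edge_in_V by blast+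
    then show ?thesis
      unfolding e(1) by (simp add: transfer_fn_sum zmono_inverse_uminus rep strain_def)
  qed
  ultimately show "\<omega> \<in> flex_spectrum p act Fv Fe"
    unfolding flex_spectrum_def using nz by blast
qed

text \<open>The usual independence of eigenvectors for distinct eigenvalues, proved by eliminating
  one multiplier from the relation.\<close>

lemma equivariant_sum_zero:
  assumes "finite A" "\<And>\<omega>. \<omega> \<in> A \<Longrightarrow> equivariant \<omega> (f \<omega>)"
    and "\<And>x. x \<in> V \<Longrightarrow> (\<Sum>\<omega>\<in>A. f \<omega> x) = 0" "\<omega> \<in> A" "x \<in> V"
  shows "f \<omega> x = 0"
  using assms
proof (induction A arbitrary: f \<omega> x rule: finite_induct)
  case (insert \<omega>0 A)
  have zero: "f \<omega> x = 0" if A: "\<omega> \<in> A" "x \<in> V" for \<omega> x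
  proof -
    obtain i where i: "\<omega> $ i \<noteq> \<omega>0 $ i"
      using A insert.hyps by (metis vec_eq_iff)
    \<comment> \<open>Translating by the i-th unit vector and subtracting
      \<open>\<omega>0 $ i\<close> times the relation removes the term of \<open>\<omega>0\<close>.
      The coordinate \<open>i\<close> is chosen so that the factor of the given \<omega> is
      nonzero.\<close>
    define g where "g \<omega> x = (\<omega> $ i - \<omega>0 $ i) *s f \<omega> x" for \<omega> x
    have "g \<omega> x = 0"
    proof (rule insert.IH[of g])
      show "equivariant \<omega> (g \<omega>)" if "\<omega> \<in> A" for \<omega>
        using insert.prems(1)[of \<omega>] that
        by (auto simp: equivariant_def g_def vec_eq_iff algebra_simps)
      show "(\<Sum>\<omega>\<in>A. g \<omega> x) = 0" if "x \<in> V" for x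
      proof -
        have "(\<Sum>\<omega>\<in>A. g \<omega> x) = (\<Sum>\<omega>\<in>insert \<omega>0 A. g \<omega> x)"
          using insert.hyps by (simp add: g_def)
        also have "\<dots> = (\<Sum>\<omega>\<in>insert \<omega>0 A. f \<omega> (act (axis i 1) x) - \<omega>0 $ i *s f \<omega> x)"
          using insert.prems(1) that
          by (intro sum.cong) (auto simp: g_def equivariant_def zmono_axis vec_eq_iff algebra_simps)
        also have "\<dots> = (\<Sum>\<omega>\<in>insert \<omega>0 A. f \<omega> (act (axis i 1) x)) - \<omega>0 $ i *s (\<Sum>\<omega>\<in>insert \<omega>0 A. f \<omega> x)"
          by (simp add: sum_subtractf vec.scale_sum_right)
        also have "\<dots> = 0"
          using insert.prems(2) that act_in_V by simp
        finally show ?thesis .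
      qed
    qed (use A in auto)
    then show ?thesis using i by (simp add: g_def)
  qed
  show ?case
  proof (cases "\<omega> = \<omega>0")
    case True
    then show ?thesis
      using insert.prems(2)[OF insert.prems(4)] insert.hyps zero insert.prems(4) by simp
  qed (use zero insert.prems in auto)
qed simp

lemma finite_spectrum_if_fin_dim:
  assumes "fin_dim_flex F"
  shows "finite (flex_spectrum p act Fv Fe)"
proof (rule ccontr)
  assume inf: "infinite (flex_spectrum p act Fv Fe)"
  obtain B where B: "finite B" "F \<subseteq> flex.span B"
    using assms unfolding fin_dim_flex_def by blast
  obtain u where u: "\<And>\<omega>. \<omega> \<in> flex_spectrum p act Fv Fe \<Longrightarrow> u \<omega> \<in> F \<and> u \<omega> \<noteq> 0 \<and> equivariant \<omega> (u \<omega>)"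
    using spectrum_iff by metis
  have "\<And>\<omega>. \<omega> \<in> flex_spectrum p act Fv Fe \<Longrightarrow> u \<omega> \<in> flex.span B"
    using u B(2) by blast
  with B(1) obtain A c where A: "finite A" "A \<subseteq> flex_spectrum p act Fv Fe" "\<exists>\<omega>\<in>A. c \<omega> \<noteq> 0"
    "(\<Sum>\<omega>\<in>A. flex_scale (c \<omega>) (u \<omega>)) = 0"
    by (rule flex.infinite_family_dependent[OF inf])
  obtain \<omega> where \<omega>: "\<omega> \<in> A" "c \<omega> \<noteq> 0" using A(3) by blast
  have "flex_scale (c \<omega>) (u \<omega>) x = 0" if "x \<in> V" for x
  proof (rule equivariant_sum_zero[OF A(1) _ _ \<omega>(1) that])
    show "equivariant \<eta> (flex_scale (c \<eta>) (u \<eta>))" if "\<eta> \<in> A" for \<eta>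
      using u[of \<eta>] that A(2)
      by (auto simp: equivariant_def flex_scale_def vec_eq_iff algebra_simps)
    show "(\<Sum>\<eta>\<in>A. flex_scale (c \<eta>) (u \<eta>) x) = 0" for x
      using A(4) by (metis sum_fun_apply zero_fun_apply)
  qed
  then have "u \<omega> x = 0" if "x \<in> V" for x
    using that \<omega>(2) by (auto simp: flex_scale_def)
  then show False
    using u[of \<omega>] \<omega>(1) A(2) unfolding F_iff by (metis ext subsetD zero_fun_apply)
qed

end

section \<open>The module of coordinate evaluations on the flex space\<close>

definition functional_scale :: "complex \<Rightarrow> ('x \<Rightarrow> complex) \<Rightarrow> 'x \<Rightarrow> complex" where
  "functional_scale c m = (\<lambda>u. c * m u)"

context crystal
begin

lemma subspace_F: "flex.subspace F"
proof (rule flex.subspaceI)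
  show "0 \<in> F" by (simp add: F_iff strain_def)
  show "u + w \<in> F" if "u \<in> F" "w \<in> F" for u w
  proof -
    have "strain (u + w) x y = strain u x y + strain w x y" for x y
      by (simp add: strain_def algebra_simps sum.distrib sum_subtractf)
    then show ?thesis using that by (simp add: F_iff)
  qed
  show "flex_scale c u \<in> F" if "u \<in> F" for c u
  proof -
    have "strain (flex_scale c u) x y = c * strain u x y" for x y
      by (simp add: strain_def flex_scale_def sum_distrib_left algebra_simps)
    then show ?thesis using that by (simp add: F_iff flex_scale_def)
  qed
qed

definition translate :: "int^'d \<Rightarrow> ('v \<Rightarrow> complex^'d) \<Rightarrow> 'v \<Rightarrow> complex^'d" where
  "translate k u = (\<lambda>x. if x \<in> V then u (act k x) else 0)"

lemma translate_in_F:
  assumes "u \<in> F" shows "translate k u \<in> F"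
  unfolding F_iff
proof (intro conjI allI impI)
  fix x y assume "{x, y} \<in> E"
  then have V: "x \<in> V" "y \<in> V" using edge_in_V by blast+
  then have "strain (translate k u) x y = strain u (act k x) (act k y)"
    by (simp add: strain_def translate_def p_act_diff)
  also have "\<dots> = 0" using assms \<open>{x, y} \<in> E\<close> edge_act[OF V] by (simp add: F_iff)
  finally show "strain (translate k u) x y = 0" .
qed (simp add: translate_def)

lemma translate_translate: "translate l (translate k u) = translate (k + l) u"
  by (auto simp: translate_def act_in_V act_add fun_eq_iff)

text \<open>The transpose of \<open>translate\<close>. Functionals on \<open>F\<close> are
  represented by total functions that are zero outside \<open>F\<close>, so that equality of
  functions means equality on \<open>F\<close>. Hence \<open>pullback 0\<close> fixes the
  evaluations but not every function, and \<open>group_rep\<close> asks for the identity law on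
  generators only.\<close>

definition pullback :: "int^'d \<Rightarrow> (('v \<Rightarrow> complex^'d) \<Rightarrow> complex) \<Rightarrow> ('v \<Rightarrow> complex^'d) \<Rightarrow> complex" where
  "pullback k m = (\<lambda>u. if u \<in> F then m (translate k u) else 0)"

definition ev :: "'v \<Rightarrow> 'd \<Rightarrow> ('v \<Rightarrow> complex^'d) \<Rightarrow> complex" where
  "ev x i = (\<lambda>u. if u \<in> F then u x $ i else 0)"

lemma pullback_ev: "x \<in> V \<Longrightarrow> pullback k (ev x i) = ev (act k x) i"
  by (auto simp: pullback_def ev_def fun_eq_iff translate_in_F) (simp add: translate_def)

sublocale rep: group_rep functional_scale pullback "(\<lambda>(v, i). ev v i) ` (Fv \<times> UNIV)"
proof
  show "pullback 0 g = g" if "g \<in> (\<lambda>(v, i). ev v i) ` (Fv \<times> UNIV)" for g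
    using that Fv_subset by (auto simp: pullback_ev act_0)
  show "finite ((\<lambda>(v, i). ev v i) ` (Fv \<times> (UNIV :: 'd set)))"
    using finite_Fv by simp
qed (auto simp: functional_scale_def pullback_def fun_eq_iff algebra_simps translate_in_F
      translate_translate)

lemma ev_in_M: assumes "x \<in> V" shows "ev x i \<in> rep.M"
proof -
  obtain v k where v: "v \<in> Fv" "x = act k v" using assms by (rule rep_exists)
  then have "ev v i \<in> rep.M" using rep.G_subset_M by auto
  then show ?thesis using rep.S_in_M[of "ev v i" k] v Fv_subset by (auto simp: pullback_ev)
qed

text \<open>The edge constraints hold identically among the evaluations on F, so every linear functional on
  their span is again a flex.\<close>

lemma scalar_quotient_spectrum:
  assumes N: "rep.invariant N" "N \<noteq> rep.M"
    and \<xi>: "\<And>k w. w \<in> rep.M \<Longrightarrow> pullback k w - functional_scale (\<xi> k) w \<in> N"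
  shows "(\<chi> i. \<xi> (axis i 1)) \<in> flex_spectrum p act Fv Fe"
proof -
  have sub: "rep.subspace N" "N \<subseteq> rep.M" using N(1) by (auto simp: rep.invariant_def)
  then obtain w0 where w0: "w0 \<in> rep.M" "w0 \<notin> N" using N(2) by blast
  obtain f :: "(('v \<Rightarrow> complex^'d) \<Rightarrow> complex) \<Rightarrow> complex"
    where f_add: "\<And>x y. f (x + y) = f x + f y"
      and f_scale: "\<And>c x. f (functional_scale c x) = c * f x"
      and f_N: "\<And>x. x \<in> N \<Longrightarrow> f x = 0" and f_w0: "f w0 = 1"
    using rep.exists_functional_vanishing_on[OF sub(1) w0(2)] by metis
  have f_0: "f 0 = 0" using f_add[of 0 0] by simp
  have f_diff: "f (x - y) = f x - f y" for x y using f_add[of "x - y" y] by simp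
  have f_sum: "f (sum h A) = (\<Sum>i\<in>A. f (h i))" for h :: "'d \<Rightarrow> _" and A
    by (induction A rule: infinite_finite_induct) (simp_all only: sum.infinite sum.empty sum.insert f_add f_0 simp_thms)
  have f_pull: "f (pullback k w) = \<xi> k * f w" if "w \<in> rep.M" for k w
    using f_N[OF \<xi>[OF that, of k]] by (simp add: f_diff f_scale)
  \<comment> \<open>The flex is read off from \<open>f\<close> through the evaluations; since
    \<open>f\<close> kills \<open>N\<close>, it turns the scalar action into the multiplier
    \<xi>.\<close>
  define u where "u x = (if x \<in> V then \<chi> i. f (ev x i) else 0)" for x
  have u_act: "u (act k x) = \<xi> k *s u x" if "x \<in> V" for k x
    using that f_pull[OF ev_in_M[OF that], of k] by (simp add: u_def act_in_V pullback_ev vec_eq_iff)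
  have uF: "u \<in> F"
    unfolding F_iff
  proof (intro conjI allI impI)
    fix x y assume xy: "{x, y} \<in> E"
    then have V: "x \<in> V" "y \<in> V" using edge_in_V by blast+
    let ?d = "\<lambda>i. complex_of_real (p x $ i - p y $ i)"
    \<comment> \<open>On \<open>F\<close> this combination is the strain of the flex
      \<open>m\<close> along an edge, and outside \<open>F\<close> all evaluations are zero.\<close>
    have "(\<Sum>i\<in>UNIV. functional_scale (?d i) (ev x i - ev y i)) m = 0" for m
    proof (cases "m \<in> F")
      case True
      then have "strain m x y = 0" using xy F_iff by blast
      then show ?thesis
        using True by (simp add: sum_fun_apply functional_scale_def ev_def strain_def mult.commute)
    qed (simp add: sum_fun_apply functional_scale_def ev_def)
    then have "(\<Sum>i\<in>UNIV. functional_scale (?d i) (ev x i - ev y i)) = 0"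
      by (simp add: fun_eq_iff)
    then have "f (\<Sum>i\<in>UNIV. functional_scale (?d i) (ev x i - ev y i)) = 0" using f_0 by simp
    then show "strain u x y = 0"
      using V by (simp only: f_sum f_scale f_diff) (simp add: strain_def u_def mult.commute)
  qed (simp add: u_def)
  \<comment> \<open>The evaluations span the module, so if \<open>f\<close> vanished on all of them
    it could not be 1 at \<open>w0\<close>.\<close>
  have "\<exists>x i. x \<in> V \<and> f (ev x i) \<noteq> 0"
  proof (rule ccontr)
    assume "\<not> ?thesis"
    then have zero: "f (ev x i) = 0" if "x \<in> V" for x i using that by blast
    have "f w = 0" if "w \<in> rep.M" for w
      using that
    proof (induction w rule: rep.M_induct)
      case (gen k g)
      then obtain v i where v: "v \<in> Fv" "g = ev v i" by auto
      then have "v \<in> V" using Fv_subset by blast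
      then show ?case using v zero act_in_V by (simp add: pullback_ev)
    qed (simp_all only: f_add f_scale f_0 mult_zero_right add_0)
    then show False using w0 f_w0 by auto
  qed
  then obtain x i where x: "x \<in> V" "u x $ i \<noteq> 0" by (auto simp: u_def)
  have "\<xi> 0 * u x $ i = u x $ i" using u_act[OF x(1), of 0] act_0[OF x(1)] by (metis vector_smult_component)
  then have \<xi>0: "\<xi> 0 = 1" using x(2) by simp
  have \<xi>_add: "\<xi> (k + l) = \<xi> k * \<xi> l" for k l
  proof -
    have "\<xi> (k + l) *s u x = \<xi> k *s (\<xi> l *s u x)"
      by (simp only: u_act[OF x(1), symmetric] u_act[OF act_in_V[OF x(1)], symmetric] act_add[OF x(1)])
    then have "\<xi> (k + l) * u x $ i = \<xi> k * \<xi> l * u x $ i"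
      by (metis mult.assoc vector_smult_component)
    then show ?thesis using x(2) by simp
  qed
  note char = character_eq_zmono[of \<xi>, OF \<xi>0 \<xi>_add]
  have "equivariant (\<chi> i. \<xi> (axis i 1)) u"
    by (simp add: equivariant_def u_act char(1)[symmetric])
  moreover have "u \<noteq> 0" using x by auto
  ultimately show ?thesis
    unfolding spectrum_iff using char(2) uF by auto
qed

section \<open>Finite spectrum implies finite dimension\<close>

definition spectrum_poly :: "'d \<Rightarrow> complex poly" where
  "spectrum_poly i = (\<Prod>\<omega>\<in>flex_spectrum p act Fv Fe. [:- (\<omega> $ i), 1:])"

text \<open>If every power failed on some generator, a scalar quotient would yield a spectral point
  whose i-th coordinate is not a root of \<open>spectrum_poly i\<close>. One exponent serves all
  generators.\<close>

lemma spectrum_poly_power_annihilates: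
  assumes fin: "finite (flex_spectrum p act Fv Fe)"
  obtains n where "\<And>v j. v \<in> Fv \<Longrightarrow>
    rep.poly_act (pullback (axis i 1)) (spectrum_poly i ^ n) (ev v j) = 0"
proof (rule ccontr)
  assume no: "\<not> thesis"
  have "\<exists>g\<in>(\<lambda>(v, i). ev v i) ` (Fv \<times> UNIV).
      rep.poly_act (pullback (axis i 1)) (spectrum_poly i ^ n) g \<noteq> 0" for n
    using no that[of n] by force
  then obtain N \<xi> where N: "rep.invariant N" "N \<noteq> rep.M"
      "\<And>k w. w \<in> rep.M \<Longrightarrow> pullback k w - functional_scale (\<xi> k) w \<in> N"
      and nz: "poly (spectrum_poly i) (\<xi> (axis i 1)) \<noteq> 0"
    using rep.exists_scalar_quotient[of "axis i 1" "spectrum_poly i"] by metis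
  have "(\<chi> i. \<xi> (axis i 1)) \<in> flex_spectrum p act Fv Fe"
    by (rule scalar_quotient_spectrum[OF N])
  then have "poly (spectrum_poly i) (\<xi> (axis i 1)) = 0"
    using fin unfolding spectrum_poly_def poly_prod by (intro prod_zero bexI) auto
  then show False using nz by contradiction
qed

text \<open>Powers of the pullback move the evaluation point along the i-th axis. An annihilating
  polynomial therefore becomes a linear recurrence for the values of every flex.\<close>

lemma poly_act_ev:
  assumes "v \<in> V" "u \<in> F"
  shows "rep.poly_act (pullback (axis i 1)) q (ev v j) (translate k u)
    = (\<Sum>t\<le>degree q. poly.coeff q t * u (act (k + axis i (int t)) v) $ j)"
proof -
  have "(pullback (axis i 1) ^^ t) (ev v j) = ev (act (axis i (int t)) v) j" for t
  proof (induction t)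
    case 0
    have "axis i 0 = (0 :: int^'d)" by (simp add: vec_eq_iff axis_def)
    then show ?case by (simp only: funpow_0 of_nat_0 act_0[OF assms(1)])
  next
    case (Suc t)
    have "axis i (int (Suc t)) = (axis i 1 + axis i (int t) :: int^'d)"
      by (simp add: vec_eq_iff axis_def)
    then show ?case
      using Suc assms(1) act_in_V by (simp add: pullback_ev act_add)
  qed
  then show ?thesis
    using assms act_in_V translate_in_F
    by (simp add: rep.poly_act_def sum_fun_apply functional_scale_def ev_def act_add)
      (simp add: translate_def act_in_V)
qed

lemma fin_dim_if_finite_spectrum:
  assumes fin: "finite (flex_spectrum p act Fv Fe)"
  shows "fin_dim_flex F"
proof -
  have "\<exists>n. \<forall>v\<in>Fv. \<forall>j. rep.poly_act (pullback (axis i 1)) (spectrum_poly i ^ n) (ev v j) = 0" for i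
    using spectrum_poly_power_annihilates[OF fin, of i] by metis
  then obtain n where n: "\<And>i v j. v \<in> Fv \<Longrightarrow>
      rep.poly_act (pullback (axis i 1)) (spectrum_poly i ^ n i) (ev v j) = 0"
    by metis
  define r where "r i = spectrum_poly i ^ n i" for i
  \<comment> \<open>The constant term is, up to sign, a power of the product of the i-th coordinates
    of the spectral points, all of them nonzero. This permits running the recurrence
    backwards.\<close>
  have r0: "poly.coeff (r i) 0 \<noteq> 0" for i
    using fin spectrum_iff
    by (auto simp: r_def spectrum_poly_def poly_0_coeff_0[symmetric] poly_prod)
  then have rD: "poly.coeff (r i) (degree (r i)) \<noteq> 0" for i
    by (metis coeff_0 leading_coeff_0_iff)
  define Box where "Box = {k :: int^'d. \<forall>i. 0 \<le> k $ i \<and> k $ i < int (degree (r i))}"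
  \<comment> \<open>The coordinates of a flex at the motif vertices translated by the finite box of
    initial values.\<close>
  define C where "C = (\<lambda>(k, v, j) (u :: 'v \<Rightarrow> complex^'d). u (act k v) $ j) ` (Box \<times> Fv \<times> UNIV)"
  have "finite C"
    unfolding C_def Box_def using finite_int_box finite_Fv by (intro finite_imageI finite_SigmaI) auto
  moreover have "h (x + y) = h x + h y" "h (flex_scale c x) = c * h x" if "h \<in> C" for h x y c
    using that by (auto simp: C_def flex_scale_def)
  ultimately have "\<exists>B. finite B \<and> B \<subseteq> F \<and> F \<subseteq> flex.span (B \<union> {u\<in>F. \<forall>h\<in>C. h u = 0})"
    by (intro flex.finite_span_modulo_functionals subspace_F)
  then obtain B where B: "finite B" "B \<subseteq> F" "F \<subseteq> flex.span (B \<union> {u\<in>F. \<forall>h\<in>C. h u = 0})"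
    by blast
  \<comment> \<open>The recurrences spread zero initial values over all translates of the motif, so
    \<open>C\<close> has no common zero in \<open>F\<close> except 0, and \<open>B\<close>
    spans.\<close>
  have "u = 0" if u: "u \<in> F" "\<forall>h\<in>C. h u = 0" for u
  proof -
    have "u (act k v) $ j = 0" if v: "v \<in> Fv" for k v j
    proof (rule recurrence_vec_zero[of "\<lambda>i. poly.coeff (r i)" "\<lambda>i. degree (r i)" "\<lambda>k. u (act k v) $ j"])
      show "(\<Sum>t\<le>degree (r i). poly.coeff (r i) t * u (act (k + axis i (int t)) v) $ j) = 0" for k i
        using poly_act_ev[of v u i "r i" j k] n[OF v, of i j] v Fv_subset u(1) by (auto simp: r_def)
      show "u (act k v) $ j = 0" if "\<forall>i. 0 \<le> k $ i \<and> k $ i < int (degree (r i))" for k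
        using u(2) v that unfolding C_def Box_def by force
    qed (use r0 rD in auto)
    then have "u (act k v) = 0" if "v \<in> Fv" for k v using that by (simp add: vec_eq_iff)
    then have "u x = 0" for x
      using u(1) by (cases "x \<in> V") (auto simp: F_iff elim: rep_exists)
    then show ?thesis by (simp add: fun_eq_iff)
  qed
  then have "B \<union> {u\<in>F. \<forall>h\<in>C. h u = 0} \<subseteq> insert 0 B" by auto
  then have "F \<subseteq> flex.span (insert 0 B)"
    using B(3) flex.span_mono by (meson subset_trans)
  then show ?thesis
    unfolding fin_dim_flex_def using B(1,2) by auto
qed

end

theorem theorem3p5:
  fixes V :: "'v set" and E :: "'v set set" and p :: "'v \<Rightarrow> real^'d"
    and act :: "int^'d \<Rightarrow> 'v \<Rightarrow> 'v" and a :: "'d \<Rightarrow> real^'d"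
    and Fv :: "'v set" and Fe :: "('v \<times> 'v) set"
  assumes "CARD('d) \<ge> 2"
    and "crystal_framework V E p act a"
    and "motif V E act Fv Fe"
  shows "fin_dim_flex (flex_space V E p) \<longleftrightarrow> finite (flex_spectrum p act Fv Fe)"
proof -
  interpret crystal V E p act a Fv Fe
    using assms by unfold_locales
  show ?thesis
    using finite_spectrum_if_fin_dim fin_dim_if_finite_spectrum by blast
qed

end
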